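(* Let $\alpha,\mu$ be real numbers with $0<\mu\le 1$ and $\alpha+\mu>0$, and let $\lambda\in\mathbb{C}$, $\lambda\ne 0$. Let $g_1,g_2\in\mathcal{A}$, and let $q_i(z)=zg_i'(z)/g_i(z)$ $(i=1,2)$ be univalent in $\mathbb{D}$ satisfying $$\operatorname{Re}\left(\frac{1}{\lambda}q_i(z)\right)>0\quad (z\in\mathbb{D})$$ and $$\operatorname{Re}\left(\left(\frac{\alpha}{\mu}-1\right)\frac{zq_i'(z)}{q_i(z)}+1+\frac{zq_i''(z)}{q_i'(z)}\right)>0\quad (z\in\mathbb{D}).$$ Let $$h_i(z):=\left(\frac{zg_i'(z)}{g_i(z)}\right)^\alpha\left((1-\lambda)\frac{zg_i'(z)}{g_i(z)}+\lambda\left(1+\frac{zg_i''(z)}{g_i'(z)}\right)\right)^\mu\quad(i=1,2).$$ If $f\in\mathcal{A}$ is such that $\frac{zf'(z)}{f(z)}\neq 0$ in $\mathbb{D}$, $\frac{zf'(z)}{f(z)}\in\mathcal{H}[1,1]\cap\mathcal{Q}$, and $$\left(\frac{zf'(z)}{f(z)}\right)^\alpha\left((1-\lambda)\frac{zf'(z)}{f(z)}+\lambda\left(1+\frac{zf''(z)}{f'(z)}\right)\right)^\mu$$ is univalent in $\mathbb{D}$, then $$h_1(z)\prec\left(\frac{zf'(z)}{f(z)}\right)^\alpha\left((1-\lambda)\frac{zf'(z)}{f(z)}+\lambda\left(1+\frac{zf''(z)}{f'(z)}\right)\right)^\mu\prec h_2(z)$$ implies $$\frac{zg_1'(z)}{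g_1(z)}\prec\frac{zf'(z)}{f(z)}\prec\frac{zg_2'(z)}{g_2(z)}.$$
   Context: $\mathbb{D}=\{z\in\mathbb{C}:|z|<1\}$; $\mathcal{H}$ is the class of analytic functions in $\mathbb{D}$; $\mathcal{H}[1,1]=\{f\in\mathcal{H}:f(0)=1\}$; $\mathcal{A}=\{f\in\mathcal{H}:f(0)=0,\ f'(0)=1\}$. Univalent means analytic and injective. For $f,g\in\mathcal{H}$, $f\prec g$ ($f$ is subordinate to $g$) means there is an analytic $w:\mathbb{D}\to\mathbb{D}$ with $w(0)=0$ and $f(z)=g(w(z))$ for all $z\in\mathbb{D}$. Functions such as $zf'(z)/f(z)$ with $f\in\mathcal{A}$ take the value $1$ at $z=0$ (removable singularity). $\mathcal{Q}$ is the set of all functions $f$ that are analytic and injective on $\overline{\mathbb{D}}\setminus E(f)$, where $E(f)=\{\zeta\in\partial\mathbb{D}:\lim_{z\to\zeta}f(z)=\infty\}$, and are such that $f'(\zeta)\ne 0$ for $\zeta\in\partial\mathbb{D}\setminus E(f)$. All powers are principal values, and it is a standing assumption that the expressions $h_1,h_2$ and the corresponding expression for $f$ are well-defined in $\mathbb{D}$, i.e. that the principal powers appearing in them are analytic functions in $\mathbb{D}$. *)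

theory Defs
  imports "HOL-Complex_Analysis.Complex_Analysis"
begin

text \<open>
  Functions on the unit disc are total functions of type \<^typ>\<open>complex \<Rightarrow> complex\<close>, of which only the
  values on the disc matter.
\<close>

abbreviation unit_disc :: "complex set" where
  "unit_disc \<equiv> ball 0 1"

definition class_H :: "(complex \<Rightarrow> complex) set" where
  "class_H = {f. f holomorphic_on unit_disc}"

definition class_H11 :: "(complex \<Rightarrow> complex) set" where
  "class_H11 = {f \<in> class_H. f 0 = 1}"

definition class_A :: "(complex \<Rightarrow> complex) set" where
  "class_A = {f \<in> class_H. f 0 = 0 \<and> deriv f 0 = 1}"

definition univalent :: "(complex \<Rightarrow> complex) \<Rightarrow> bool" where
  "univalent f \<longleftrightarrow> f holomorphic_on unit_disc \<and> inj_on f unit_disc"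

definition subordinate :: "(complex \<Rightarrow> complex) \<Rightarrow> (complex \<Rightarrow> complex) \<Rightarrow> bool"
    (infix "\<prec>" 50) where
  "f \<prec> g \<longleftrightarrow> f \<in> class_H \<and> g \<in> class_H \<and>
     (\<exists>w. w holomorphic_on unit_disc \<and> w ` unit_disc \<subseteq> unit_disc \<and> w 0 = 0 \<and>
          (\<forall>z\<in>unit_disc. f z = g (w z)))"

definition exc_set :: "(complex \<Rightarrow> complex) \<Rightarrow> complex set" where
  "exc_set f = {\<zeta> \<in> sphere 0 1. filterlim f at_infinity (at \<zeta> within unit_disc)}"

text \<open>
  A function that is given on the open disc belongs to \<open>class_Q\<close> if it has an extension \<open>F\<close> with the
  required properties on the closed disc minus the exceptional set. The junk values of \<open>f\<close> outside
  the open disc play no role: \<open>exc_set f\<close> only depends on \<open>f\<close> inside the disc, and so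
  \<open>exc_set F = exc_set f\<close>. Being analytic on a set that is not open means, as usual,
  being holomorphic in a neighbourhood of each of its points.
\<close>

definition class_Q :: "(complex \<Rightarrow> complex) set" where
  "class_Q = {f. \<exists>F. (\<forall>z\<in>unit_disc. F z = f z) \<and>
     F analytic_on (cball 0 1 - exc_set f) \<and>
     inj_on F (cball 0 1 - exc_set f) \<and>
     (\<forall>\<zeta>\<in>sphere 0 1 - exc_set f. deriv F \<zeta> \<noteq> 0)}"

text \<open>
  \<open>z f'(z) / f(z)\<close> with its removable singularity at the origin filled in. For \<open>f\<close> in \<open>class_A\<close>,
  a zero of \<open>f\<close> away from the origin is a pole of this quotient; the convention \<open>x / 0 = 0\<close> does not
  hide it, since the resulting function is then unbounded near that point and hence not holomorphic
  on the disc.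
\<close>

definition zlogderiv :: "(complex \<Rightarrow> complex) \<Rightarrow> complex \<Rightarrow> complex" where
  "zlogderiv f z = (if z = 0 then 1 else z * deriv f z / f z)"

definition affine_comb :: "complex \<Rightarrow> (complex \<Rightarrow> complex) \<Rightarrow> complex \<Rightarrow> complex" where
  "affine_comb l f z = (1 - l) * zlogderiv f z + l * (1 + z * deriv (deriv f) z / deriv f z)"

text \<open>On complex numbers, \<open>powr\<close> is the principal power \<open>exp (a * Ln w)\<close> for \<open>w \<noteq> 0\<close>.\<close>

definition power_expr :: "real \<Rightarrow> real \<Rightarrow> complex \<Rightarrow> (complex \<Rightarrow> complex) \<Rightarrow> complex \<Rightarrow> complex" where
  "power_expr \<alpha> \<mu> l f z =
     zlogderiv f z powr complex_of_real \<alpha> * affine_comb l f z powr complex_of_real \<mu>"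

definition powers_analytic :: "real \<Rightarrow> real \<Rightarrow> complex \<Rightarrow> (complex \<Rightarrow> complex) \<Rightarrow> bool" where
  "powers_analytic \<alpha> \<mu> l f \<longleftrightarrow>
     (\<lambda>z. zlogderiv f z powr complex_of_real \<alpha>) holomorphic_on unit_disc \<and>
     (\<lambda>z. affine_comb l f z powr complex_of_real \<mu>) holomorphic_on unit_disc"

end

theory Submission
  imports Defs
begin

text \<open>
  Write \<open>p\<close> and \<open>q\<close> for the logarithmic derivatives \<open>z f' / f\<close> and \<open>z g' / g\<close>, and \<open>b = \<alpha> / \<mu>\<close>. The
  \<open>\<mu>\<close>-th roots of the expressions in question are \<open>p\<^sup>b (p + \<lambda> z p' / p)\<close> and \<open>H 1\<close>, where
  \<open>H t = q\<^sup>b (q + t \<lambda> z q' / q)\<close>. The two conditions on \<open>q\<close> say that \<open>H t\<close> is close-to-convex with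
  respect to a fixed convex function, the primitive of \<open>\<lambda> q' q\<^sup>b / q\<close>. It follows that \<open>H s\<close> on a disc
  about the origin omits the values of \<open>H t\<close>, \<open>t \<ge> s\<close>, at all points of larger modulus.

  Where the inclusion of images fails, Jack's lemma gives points with \<open>p z = q \<zeta>\<close>
  (or \<open>q z = p \<zeta>\<close>), \<open>\<bar>z\<bar> < \<bar>\<zeta>\<bar> < 1\<close> and \<open>z p' z = m \<zeta> q' \<zeta>\<close> (or \<open>z q' z = m \<zeta> p' \<zeta>\<close>) with
  real \<open>m \<ge> 1\<close>. There the expression for \<open>p\<close> takes a value of \<open>H m\<close> (or of \<open>H (1/m)\<close>), and Schwarz's
  lemma for the given subordination yields a contradiction.
\<close>

section \<open>Convex functions and close-to-convex chains\<close>

lemma has_real_derivative_Re_on_circle: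
  assumes "(f has_field_derivative D) (at (\<zeta> * cis x))"
  shows "((\<lambda>x. Re (f (\<zeta> * cis x))) has_real_derivative Re (\<i> * (\<zeta> * cis x) * D)) (at x)"
proof -
  have "((\<lambda>x. \<zeta> * cis x) has_vector_derivative \<i> * (\<zeta> * cis x)) (at x)"
    unfolding cis_conv_exp by (auto intro!: derivative_eq_intros has_vector_derivative_real_field)
  from field_vector_diff_chain_at[OF this] assms
  have "((\<lambda>x. f (\<zeta> * cis x)) has_vector_derivative \<i> * (\<zeta> * cis x) * D) (at x)"
    by (auto simp: o_def)
  then show ?thesis
    by (rule has_field_derivative_Re)
qed

lemma deriv_exp_quotient:
  assumes k: "k holomorphic_on S" "open S" and eq: "\<And>w. w \<in> S \<Longrightarrow> exp (k w) = f w" and "z \<in> S"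
  shows "deriv f z / f z = deriv k z"
proof -
  have "(k has_field_derivative deriv k z) (at z)"
    using holomorphic_derivI k \<open>z \<in> S\<close> by blast
  then have "((\<lambda>w. exp (k w)) has_field_derivative f z * deriv k z) (at z)"
    using eq \<open>z \<in> S\<close> by (auto intro!: derivative_eq_intros)
  moreover have "\<forall>\<^sub>F w in nhds z. exp (k w) = f w"
    using eventually_nhds_in_open[OF \<open>open S\<close> \<open>z \<in> S\<close>] eq by (auto elim: eventually_mono)
  ultimately have "(f has_field_derivative f z * deriv k z) (at z)"
    using DERIV_cong_ev[OF refl _ refl, of "\<lambda>w. exp (k w)" f z] by simp
  then show ?thesis
    using eq[OF \<open>z \<in> S\<close>] by (auto simp: DERIV_imp_deriv)
qed

text \<open>\<open>pos\<close> is the classical criterion Re (1 + z K'' / K') > 0 for a convex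
  univalent function. It is written for the derivative \<open>\<kappa>\<close>, because in the
  application \<open>\<kappa>\<close> is an explicit formula and \<open>K\<close> merely one of its
  primitives.\<close>

locale convex_primitive =
  fixes K \<kappa> :: "complex \<Rightarrow> complex"
  assumes deriv_K: "z \<in> ball 0 1 \<Longrightarrow> (K has_field_derivative \<kappa> z) (at z)"
    and hol: "\<kappa> holomorphic_on ball 0 1"
    and nonzero: "z \<in> ball 0 1 \<Longrightarrow> \<kappa> z \<noteq> 0"
    and pos: "z \<in> ball 0 1 \<Longrightarrow> 0 < Re (1 + z * deriv \<kappa> z / \<kappa> z)"
begin

lemma K_hol: "K holomorphic_on ball 0 1"
  unfolding holomorphic_on_open[OF open_ball]
proof
  fix z :: complex assume "z \<in> ball 0 1"
  then show "\<exists>D. (K has_field_derivative D) (at z)" using deriv_K[of z] by blast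
qed

lemma K_cont: "continuous_on (ball 0 1) K"
  by (rule holomorphic_on_imp_continuous_on[OF K_hol])

text \<open>The outward normal \<open>z \<kappa> z\<close> of the curve \<open>K (r cis x)\<close> turns monotonically, and once around
  in total. So the projection of the curve onto a fixed normal first decreases, then increases.\<close>

lemma support_on_circle:
  assumes \<zeta>: "\<zeta> \<in> ball 0 1" "\<zeta> \<noteq> 0" and x: "0 < x" "x < 2 * pi"
  shows "0 < Re ((K \<zeta> - K (\<zeta> * cis x)) * cnj (\<zeta> * \<kappa> \<zeta>))"
proof -
  obtain k where k: "k holomorphic_on ball 0 1" "\<And>z. z \<in> ball 0 1 \<Longrightarrow> exp (k z) = \<kappa> z"
    using holomorphic_logarithm_exists[of "ball 0 1" \<kappa> 0] hol nonzero by auto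
  have circ: "\<zeta> * cis y \<in> ball 0 1" for y
    using \<zeta> by (simp add: norm_mult)
  \<comment> \<open>\<open>a y\<close> is a continuous choice of the angle between the normals at
    \<open>\<zeta>\<close> and at \<open>\<zeta> * cis y\<close>. By \<open>pos\<close> it increases
    strictly; over a full turn it grows by \<open>2 * pi\<close> because \<open>k\<close> is
    single-valued.\<close>
  define a where "a y = y + Im (k (\<zeta> * cis y)) - Im (k \<zeta>)" for y
  have da: "\<exists>D. (a has_real_derivative D) (at y) \<and> 0 < D" for y
  proof -
    define z where "z = \<zeta> * cis y"
    have z: "z \<in> ball 0 1" using circ z_def by simp
    have "(k has_field_derivative deriv k z) (at z)"
      using holomorphic_derivI[OF k(1) _ z] by simp
    then have "((\<lambda>w. -\<i> * k w) has_field_derivative - \<i> * deriv k z) (at z)"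
      by (rule DERIV_cmult)
    from has_real_derivative_Re_on_circle[OF this[unfolded z_def]]
    have "((\<lambda>y. Im (k (\<zeta> * cis y))) has_real_derivative Re (z * deriv k z)) (at y)"
      unfolding z_def[symmetric] by simp
    then have "(a has_real_derivative 1 + Re (z * deriv k z) - 0) (at y)"
      unfolding a_def by (intro derivative_intros)
    moreover have "0 < 1 + Re (z * deriv k z)"
      using pos[OF z] deriv_exp_quotient[OF k(1) _ k(2) z]
      by (metis Re_complex_of_real divide_inverse mult.assoc of_real_1 open_ball plus_complex.sel(1))
    ultimately show ?thesis by (metis diff_0_right)
  qed
  have a_mono: "a u < a v" if "u < v" for u v
    using DERIV_pos_imp_increasing[OF that] da by blast
  have "continuous_on {0..2*pi} a"
    using da by (meson DERIV_atLeastAtMost_imp_continuous_on)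
  moreover have a0: "a 0 = 0" and a2: "a (2*pi) = 2*pi"
    by (simp_all add: a_def)
  \<comment> \<open>At \<open>x1\<close> the normal is opposite to the one at
    \<open>\<zeta>\<close>; there the projection \<open>\<phi>\<close> below passes from decreasing
    to increasing.\<close>
  ultimately obtain x1 where x1: "0 \<le> x1" "x1 \<le> 2*pi" "a x1 = pi"
    using IVT'[of a 0 pi "2*pi"] by auto
  define n where "n = \<zeta> * \<kappa> \<zeta>"
  have n: "n \<noteq> 0" using \<zeta> nonzero by (simp add: n_def)
  define \<phi> where "\<phi> y = Re (K (\<zeta> * cis y) * cnj n)" for y
  have d\<phi>: "\<exists>r. (\<phi> has_real_derivative - r * sin (a y)) (at y) \<and> 0 < r" for y
  proof -
    define z where "z = \<zeta> * cis y"
    have z: "z \<in> ball 0 1" using circ z_def by simp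
    have "((\<lambda>w. K w * cnj n) has_field_derivative \<kappa> z * cnj n) (at z)"
      using deriv_K[OF z] by (rule DERIV_cmult_right)
    from has_real_derivative_Re_on_circle[OF this[unfolded z_def]]
    have "(\<phi> has_real_derivative Re (\<i> * z * (\<kappa> z * cnj n))) (at y)"
      unfolding z_def[symmetric] \<phi>_def by simp
    moreover have "z * (\<kappa> z * cnj n) = ((cmod \<zeta>)\<^sup>2 * exp (Re (k z) + Re (k \<zeta>))) * cis (a y)"
    proof -
      have "\<kappa> z * cnj (\<kappa> \<zeta>) = exp (Re (k z) + Re (k \<zeta>)) * cis (Im (k z) - Im (k \<zeta>))"
        unfolding k(2)[OF z, symmetric] k(2)[OF \<zeta>(1), symmetric]
        by (simp add: exp_eq_polar[of "k _"] exp_add cis_cnj cis_divide[symmetric] divide_inverse)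
      moreover have "z * cnj \<zeta> = (cmod \<zeta>)\<^sup>2 * cis y"
        using complex_norm_square[of \<zeta>] by (simp add: z_def)
      ultimately have "(z * cnj \<zeta>) * (\<kappa> z * cnj (\<kappa> \<zeta>))
          = (cmod \<zeta>)\<^sup>2 * cis y * (exp (Re (k z) + Re (k \<zeta>)) * cis (Im (k z) - Im (k \<zeta>)))"
        by simp
      also have "\<dots> = ((cmod \<zeta>)\<^sup>2 * exp (Re (k z) + Re (k \<zeta>))) * (cis y * cis (Im (k z) - Im (k \<zeta>)))"
        by simp
      also have "cis y * cis (Im (k z) - Im (k \<zeta>)) = cis (a y)"
        by (simp add: cis_mult a_def z_def add_diff_eq)
      finally show ?thesis by (simp add: n_def mult_ac)
    qed
    ultimately have "(\<phi> has_real_derivative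
        - ((cmod \<zeta>)\<^sup>2 * exp (Re (k z) + Re (k \<zeta>))) * sin (a y)) (at y)"
      by (simp add: mult.assoc)
    moreover have "0 < (cmod \<zeta>)\<^sup>2 * exp (Re (k z) + Re (k \<zeta>))"
      using \<zeta> by simp
    ultimately show ?thesis by blast
  qed
  have \<phi>_cont: "continuous_on {u..v} \<phi>" for u v
    using d\<phi> by (meson DERIV_atLeastAtMost_imp_continuous_on)
  have "\<phi> x < \<phi> 0"
  proof (cases "x \<le> x1")
    case True
    show ?thesis
    proof (rule DERIV_neg_imp_decreasing_open[OF x(1) _ \<phi>_cont])
      fix y assume y: "0 < y" "y < x"
      then have "0 < a y" "a y < pi"
        using a_mono[of 0 y] a_mono[of y x1] a0 x1 True by auto
      then have "0 < sin (a y)" by (rule sin_gt_zero)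
      then show "\<exists>D. (\<phi> has_real_derivative D) (at y) \<and> D < 0"
        using d\<phi>[of y] by (metis mult_neg_pos neg_less_0_iff_less)
    qed
  next
    case False
    have "\<phi> x < \<phi> (2*pi)"
    proof (rule DERIV_pos_imp_increasing_open[OF x(2) _ \<phi>_cont])
      fix y assume y: "x < y" "y < 2*pi"
      then have "pi < a y" "a y < 2*pi"
        using a_mono[of x1 y] a_mono[of y "2*pi"] a2 x1 False by auto
      then have "sin (a y) < 0"
        by (rule sin_lt_zero)
      then show "\<exists>D. (\<phi> has_real_derivative D) (at y) \<and> 0 < D"
        using d\<phi>[of y] by (metis mult_neg_neg neg_less_0_iff_less)
    qed
    then show ?thesis by (simp add: \<phi>_def)
  qed
  then show ?thesis
    by (simp add: \<phi>_def n_def left_diff_distrib)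
qed

lemma support_circle:
  assumes \<zeta>: "\<zeta> \<in> ball 0 1" and z: "cmod z = cmod \<zeta>" "z \<noteq> \<zeta>"
  shows "0 < Re ((K \<zeta> - K z) * cnj (\<zeta> * \<kappa> \<zeta>))"
proof -
  have "\<zeta> \<noteq> 0" using z by auto
  define x where "x = Arg2pi (z / \<zeta>)"
  have "cmod (z / \<zeta>) = 1" using z \<open>\<zeta> \<noteq> 0\<close> by (simp add: norm_divide)
  then have zx: "z = \<zeta> * cis x"
    using Arg2pi_eq[of "z / \<zeta>"] \<open>\<zeta> \<noteq> 0\<close> by (simp add: x_def cis_conv_exp field_simps)
  have "0 \<le> x" "x < 2*pi" by (simp_all add: x_def Arg2pi_ge_0 Arg2pi_lt_2pi)
  moreover have "x \<noteq> 0" using zx z by auto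
  ultimately show ?thesis
    using support_on_circle[OF \<zeta> \<open>\<zeta> \<noteq> 0\<close>] zx by simp
qed

text \<open>The maximum principle for the real part carries the weak inequality from the circle into
  the disc. It is strict there because the open image of the smaller disc would otherwise contain a
  value further out.\<close>

lemma support:
  assumes \<zeta>: "\<zeta> \<in> ball 0 1" and z: "cmod z \<le> cmod \<zeta>" "z \<noteq> \<zeta>"
  shows "0 < Re ((K \<zeta> - K z) * cnj (\<zeta> * \<kappa> \<zeta>))"
proof (cases "cmod z = cmod \<zeta>")
  case True
  then show ?thesis using support_circle \<zeta> z by blast
next
  case False
  define r where "r = cmod \<zeta>"
  have r: "r < 1" "cmod z < r" using \<zeta> False z by (auto simp: r_def)
  define n where "n = \<zeta> * \<kappa> \<zeta>"
  have n: "n \<noteq> 0" using r nonzero \<zeta> by (auto simp: n_def r_def)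
  define f where "f w = K w * cnj n" for w
  have sub: "cball 0 r \<subseteq> ball (0::complex) 1" "ball 0 r \<subseteq> ball (0::complex) 1"
    using r by auto
  have f_hol: "f holomorphic_on ball 0 1"
    unfolding f_def by (intro holomorphic_intros K_hol)
  have df: "(f has_field_derivative \<kappa> w * cnj n) (at w)" if "w \<in> ball 0 1" for w
    unfolding f_def using deriv_K[OF that] by (rule DERIV_cmult_right)
  have le: "Re (f w) \<le> Re (f \<zeta>)" if "w \<in> ball 0 r" for w
  proof (rule maximum_real_frontier[of f "ball 0 r"])
    show "f holomorphic_on interior (ball 0 r)"
      using f_hol sub holomorphic_on_subset by (auto simp: interior_open)
    show "continuous_on (closure (ball 0 r)) f"
      using holomorphic_on_imp_continuous_on[OF f_hol] sub continuous_on_subset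
        r by (metis closure_ball dual_order.strict_trans2 norm_ge_zero)
    show "Re (f u) \<le> Re (f \<zeta>)" if "u \<in> frontier (ball 0 r)" for u
    proof (cases "u = \<zeta>")
      case False
      have "cmod u = cmod \<zeta>" using that r frontier_ball[of r "0 :: complex"] norm_ge_zero[of z]
        unfolding r_def by (metis mem_sphere_0 order_le_less_trans)
      from support_circle[OF \<zeta> this False] show ?thesis
        by (simp add: f_def n_def left_diff_distrib)
    qed simp
  qed (use that in auto)
  have "Re (f z) \<noteq> Re (f \<zeta>)"
  proof
    assume eq: "Re (f z) = Re (f \<zeta>)"
    have "\<not> f constant_on ball 0 1"
    proof
      assume "f constant_on ball 0 1"
      then obtain c where "\<And>w. w \<in> ball 0 1 \<Longrightarrow> f w = c"
        by (auto simp: constant_on_def)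
      then have "(f has_field_derivative 0) (at \<zeta>)"
        using has_field_derivative_transform_within_open[OF DERIV_const[of c] open_ball \<zeta>] by metis
      then show False
        using DERIV_unique[OF df[OF \<zeta>]] n nonzero[OF \<zeta>]
        by (metis complex_cnj_zero_iff mult_eq_0_iff)
    qed
    then have "open (f ` ball 0 r)"
      by (intro open_mapping_thm[OF f_hol]) (use sub in auto)
    then obtain e where "e > 0" and e: "ball (f z) e \<subseteq> f ` ball 0 r"
      using r by (metis dist_0_norm imageI mem_ball open_contains_ball)
    have "f z + of_real (e/2) \<in> ball (f z) e"
      using \<open>e > 0\<close> by (simp add: dist_norm)
    then obtain w where "w \<in> ball 0 r" "f w = f z + of_real (e/2)"
      using e by (metis image_iff subsetD)
    with le[of w] eq \<open>e > 0\<close> show False by simp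
  qed
  with le[of z] r show ?thesis
    by (simp add: f_def n_def left_diff_distrib)
qed

text \<open>Of two points with equal values, the one of larger modulus can serve as
  \<open>\<zeta>\<close> in \<open>support\<close>, whose strict inequality then fails.\<close>

lemma K_inj: "inj_on K (ball 0 1)"
proof (rule inj_onI, rule ccontr)
  fix z w assume *: "z \<in> ball 0 1" "w \<in> ball 0 1" "K z = K w" "z \<noteq> w"
  show False
  proof (cases "cmod w \<le> cmod z")
    case True
    then show False using support[of z w] * by (simp del: times_complex.sel)
  next
    case False
    then show False using support[of w z] * by (simp del: times_complex.sel)
  qed
qed

text \<open>A compact set with interior points is convex as soon as it has a supporting line at every
  frontier point.\<close>

lemma K_convex:
  assumes r: "0 < r" "r < 1"
  shows "convex (K ` cball 0 r)"
proof (rule convexI, rule ccontr)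
  fix a b :: complex and u v :: real
  assume a: "a \<in> K ` cball 0 r" and b: "b \<in> K ` cball 0 r" and uv: "0 \<le> u" "0 \<le> v" "u + v = 1"
  define x where "x = u *\<^sub>R a + v *\<^sub>R b"
  assume "u *\<^sub>R a + v *\<^sub>R b \<notin> K ` cball 0 r"
  then have x: "x \<notin> K ` cball 0 r" by (simp add: x_def)
  define M where "M = K ` cball 0 r"
  have sub: "cball 0 r \<subseteq> ball (0::complex) 1" "ball 0 r \<subseteq> ball (0::complex) 1"
    using r by auto
  have "K 0 \<in> M" unfolding M_def using r by auto
  then obtain c where c: "c \<in> closed_segment (K 0) x" "c \<in> frontier M"
    using connected_Int_frontier[of "closed_segment (K 0) x" M] x
    by (force simp: M_def)
  have "compact M"
    unfolding M_def
    by (intro compact_continuous_image continuous_on_subset[OF K_cont sub(1)]) auto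
  then have "c \<in> M" using c compact_imp_closed frontier_subset_closed by blast
  then obtain \<zeta> where \<zeta>: "cmod \<zeta> \<le> r" "c = K \<zeta>" by (auto simp: M_def)
  have \<zeta>1: "\<zeta> \<in> ball 0 1" using \<zeta> r by auto
  have "cmod \<zeta> = r"
  proof (rule ccontr)
    assume "cmod \<zeta> \<noteq> r"
    then have "c \<in> K ` ball 0 r" using \<zeta> by auto
    moreover have "open (K ` ball 0 r)"
      by (rule open_mapping_thm3)
        (use K_hol K_inj sub in \<open>auto intro: holomorphic_on_subset inj_on_subset\<close>)
    moreover have "K ` ball 0 r \<subseteq> M" unfolding M_def by auto
    ultimately have "c \<in> interior M" by (metis interiorI)
    then show False using c by (simp add: frontier_def)
  qed
  \<comment> \<open>\<open>h\<close> is, up to a positive factor, the signed depth below the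
    supporting line at \<open>c\<close>. It is affine, positive at \<open>K 0\<close> and
    nonnegative at \<open>x\<close>, so it cannot vanish at \<open>c\<close>, which lies on the
    segment between them and differs from \<open>x\<close>.\<close>
  define h where "h w = Re ((c - w) * cnj (\<zeta> * \<kappa> \<zeta>))" for w
  have hM: "0 \<le> h w" if "w \<in> M" for w
  proof -
    obtain z where "cmod z \<le> r" "w = K z" using \<open>w \<in> M\<close> by (auto simp: M_def)
    then show ?thesis
      using support[OF \<zeta>1, of z] \<open>cmod \<zeta> = r\<close> \<zeta> by (cases "z = \<zeta>") (auto simp: h_def)
  qed
  have h0: "0 < h (K 0)"
    using support[OF \<zeta>1, of 0] \<zeta> r \<open>cmod \<zeta> = r\<close> by (force simp: h_def)
  have h_affine: "h (s *\<^sub>R p + t *\<^sub>R q) = s * h p + t * h q" if "s + t = 1" for s t p q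
  proof -
    have "c = s *\<^sub>R c + t *\<^sub>R c" using that by (metis scaleR_add_left scaleR_one)
    then have "c - (s *\<^sub>R p + t *\<^sub>R q) = s *\<^sub>R (c - p) + t *\<^sub>R (c - q)"
      by (simp add: algebra_simps)
    then have "(c - (s *\<^sub>R p + t *\<^sub>R q)) * cnj (\<zeta> * \<kappa> \<zeta>)
        = s *\<^sub>R ((c - p) * cnj (\<zeta> * \<kappa> \<zeta>)) + t *\<^sub>R ((c - q) * cnj (\<zeta> * \<kappa> \<zeta>))"
      by (simp only: distrib_right mult_scaleR_left)
    then show ?thesis unfolding h_def by (simp only: plus_complex.sel scaleR_complex.sel)
  qed
  have "0 \<le> h x"
    unfolding x_def h_affine[OF uv(3)] using hM[of a] hM[of b] a b uv
    by (simp add: M_def)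
  moreover obtain t where t: "0 \<le> t" "t \<le> 1" "c = (1 - t) *\<^sub>R K 0 + t *\<^sub>R x"
    using c by (auto simp: closed_segment_def)
  moreover have "h c = 0" by (simp add: h_def)
  moreover have "t \<noteq> 1" using t \<open>c \<in> M\<close> x by (auto simp: M_def)
  ultimately show False
    using h_affine[of "1 - t" t "K 0" x] h0
    by (smt (verit) mult_nonneg_nonneg mult_pos_pos)
qed

text \<open>The Noshiro--Warschawski argument along the segment from \<open>K \<zeta>\<close> to \<open>K z\<close>.\<close>

lemma quotient_pos:
  assumes T: "T holomorphic_on ball 0 1"
    and pos_T: "\<And>z. z \<in> ball 0 1 \<Longrightarrow> 0 < Re (deriv T z / \<kappa> z)"
    and z: "z \<in> ball 0 1" and \<zeta>: "\<zeta> \<in> ball 0 1" and "z \<noteq> \<zeta>"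
  shows "0 < Re ((T z - T \<zeta>) / (K z - K \<zeta>))"
proof -
  obtain g where g: "g holomorphic_on K ` ball 0 1"
      "\<And>z. z \<in> ball 0 1 \<Longrightarrow> deriv K z * deriv g (K z) = 1"
      "\<And>z. z \<in> ball 0 1 \<Longrightarrow> g (K z) = z"
    using holomorphic_has_inverse[OF K_hol open_ball K_inj] by blast
  have opK: "open (K ` ball 0 1)"
    by (rule open_mapping_thm3[OF K_hol open_ball K_inj])
  define r where "r = max (cmod z) (cmod \<zeta>)"
  have r: "0 < r" "r < 1"
    using z \<zeta> \<open>z \<noteq> \<zeta>\<close> by (auto simp: r_def less_max_iff_disj)
  have conv: "convex (K ` cball 0 r)" by (rule K_convex[OF r])
  define d where "d = K z - K \<zeta>"
  have d: "d \<noteq> 0" using K_inj z \<zeta> \<open>z \<noteq> \<zeta>\<close> by (auto simp: d_def inj_on_def)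
  define p where "p s = K \<zeta> + of_real s * d" for s :: real
  have pK: "\<exists>w\<in>ball 0 1. p s = K w" if "0 \<le> s" "s \<le> 1" for s
  proof -
    have "K \<zeta> \<in> K ` cball 0 r" "K z \<in> K ` cball 0 r" by (auto simp: r_def)
    from convexD_alt[OF conv this that] have "p s \<in> K ` cball 0 r"
      by (simp add: p_def d_def scaleR_conv_of_real algebra_simps)
    then show ?thesis using r by force
  qed
  \<comment> \<open>Since \<open>g\<close> inverts \<open>K\<close>, the composition of
    \<open>T\<close> with \<open>g\<close> has derivative \<open>deriv T / \<kappa>\<close>; the
    direction \<open>d\<close> of the segment cancels, and \<open>pos_T\<close> applies.\<close>
  define \<phi> where "\<phi> s = Re (T (g (p s)) / d)" for s
  have "\<phi> 0 < \<phi> 1"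
  proof (rule DERIV_pos_imp_increasing[of 0 1 \<phi>])
    fix s :: real assume s: "0 \<le> s" "s \<le> 1"
    obtain w where w: "w \<in> ball 0 1" "p s = K w" using pK[OF s] by blast
    have dK: "deriv K w = \<kappa> w" using deriv_K[OF w(1)] by (rule DERIV_imp_deriv)
    have "(g has_field_derivative deriv g (K w)) (at (p s))"
      using holomorphic_derivI[OF g(1) opK] w by auto
    moreover have "deriv g (K w) = 1 / \<kappa> w"
      using g(2)[OF w(1)] dK nonzero[OF w(1)] by (simp add: field_simps)
    moreover have "(T has_field_derivative deriv T w) (at (g (p s)))"
      using holomorphic_derivI[OF T open_ball w(1)] g(3)[OF w(1)] w(2) by simp
    ultimately have "((\<lambda>u. T (g u)) has_field_derivative deriv T w * (1 / \<kappa> w)) (at (p s))"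
      by (intro DERIV_chain2[where f = T]) auto
    moreover have "(p has_vector_derivative d) (at s)"
      unfolding p_def by (auto intro!: derivative_eq_intros has_vector_derivative_real_field)
    ultimately have "((\<lambda>s. T (g (p s))) has_vector_derivative d * (deriv T w * (1 / \<kappa> w))) (at s)"
      using field_vector_diff_chain_at[of p d s "\<lambda>u. T (g u)"] unfolding o_def by blast
    then have "((\<lambda>s. T (g (p s)) / d) has_vector_derivative d * (deriv T w * (1 / \<kappa> w)) / d) (at s)"
      by (rule has_vector_derivative_divide)
    then have "(\<phi> has_real_derivative Re (d * (deriv T w * (1 / \<kappa> w)) / d)) (at s)"
      unfolding \<phi>_def by (rule has_field_derivative_Re)
    moreover have "d * (deriv T w * (1 / \<kappa> w)) / d = deriv T w / \<kappa> w"
      using d by simp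
    ultimately show "\<exists>D. (\<phi> has_real_derivative D) (at s) \<and> 0 < D"
      using pos_T[OF w(1)] by auto
  qed simp
  then show ?thesis
    using g(3)[OF z] g(3)[OF \<zeta>] by (simp add: \<phi>_def p_def d_def diff_divide_distrib)
qed

text \<open>A point \<open>T z\<close> on this ray would make \<open>K z - K \<zeta>\<close> a
  nonnegative multiple of \<open>\<zeta> * \<kappa> \<zeta> / c\<close> with
  \<open>Re c > 0\<close>, hence of nonnegative component along the normal, against
  \<open>support\<close>. The case \<open>t = 0\<close> is what gives injectivity.\<close>

lemma ray_avoids:
  assumes T: "T holomorphic_on ball 0 1"
    and pos_T: "\<And>z. z \<in> ball 0 1 \<Longrightarrow> 0 < Re (deriv T z / \<kappa> z)"
    and \<zeta>: "\<zeta> \<in> ball 0 1" and z: "cmod z \<le> cmod \<zeta>" "z \<noteq> \<zeta>" and "0 \<le> t"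
  shows "T z \<noteq> T \<zeta> + of_real t * (\<zeta> * \<kappa> \<zeta>)"
proof
  assume eq: "T z = T \<zeta> + of_real t * (\<zeta> * \<kappa> \<zeta>)"
  have z1: "z \<in> ball 0 1" using \<zeta> z by auto
  define n where "n = \<zeta> * \<kappa> \<zeta>"
  define c where "c = (T z - T \<zeta>) / (K z - K \<zeta>)"
  have "0 < Re c" unfolding c_def by (rule quotient_pos[OF T pos_T z1 \<zeta> z(2)])
  have "c * (K z - K \<zeta>) = t * n"
    using eq \<open>0 < Re c\<close> by (auto simp: c_def n_def)
  moreover have "c * ((K \<zeta> - K z) * cnj n) = - (c * (K z - K \<zeta>)) * cnj n"
    by (simp add: algebra_simps)
  ultimately have "c * ((K \<zeta> - K z) * cnj n) = - (t * (n * cnj n))"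
    by simp
  \<comment> \<open>Multiplication by the conjugate of \<open>c\<close> turns the factor
    \<open>c\<close> on the left into a positive real number, so that real parts can be
    compared.\<close>
  then have "(K \<zeta> - K z) * cnj n * ((cmod c)\<^sup>2) = - (t * (n * cnj n)) * cnj c"
    unfolding complex_norm_square by (metis mult.commute mult.left_commute)
  also have "\<dots> = of_real (- t * (cmod n)\<^sup>2) * cnj c"
    unfolding complex_norm_square[symmetric] by simp
  finally have "Re ((K \<zeta> - K z) * cnj n) * (cmod c)\<^sup>2 = - t * (cmod n)\<^sup>2 * Re c"
    by (drule_tac arg_cong[where f = Re]) (simp flip: of_real_power)
  moreover have "- t * (cmod n)\<^sup>2 * Re c \<le> 0"
    using \<open>0 \<le> t\<close> \<open>0 < Re c\<close> by (simp add: mult_nonneg_nonneg)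
  moreover have "0 < Re ((K \<zeta> - K z) * cnj n) * (cmod c)\<^sup>2"
    using support[OF \<zeta> z] \<open>0 < Re c\<close> unfolding n_def
    by (intro mult_pos_pos) auto
  ultimately show False by linarith
qed

text \<open>As \<open>t\<close> grows, each value moves along the ray of \<open>ray_avoids\<close>,
  in the direction of the normal \<open>z * \<kappa> z\<close> at its own point.\<close>

definition chain :: "(complex \<Rightarrow> complex) \<Rightarrow> real \<Rightarrow> complex \<Rightarrow> complex" where
  "chain T t z = T z + of_real t * (z * \<kappa> z)"

section \<open>Univalence and nested images of the chain members\<close>

context
  fixes T
  assumes T: "T holomorphic_on ball 0 1"
    and pos_T: "\<And>z. z \<in> ball 0 1 \<Longrightarrow> 0 < Re (deriv T z / \<kappa> z)"
begin

lemma chain_hol: "chain T t holomorphic_on ball 0 1"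
  unfolding chain_def[abs_def] by (intro holomorphic_intros T hol)

text \<open>The quotient grows by \<open>t\<close> times the expression in \<open>pos\<close>. So
  every member inherits the hypothesis on \<open>T\<close>, and the ray argument can start from any
  parameter.\<close>

lemma chain_pos:
  assumes "0 \<le> t" and z: "z \<in> ball 0 1"
  shows "0 < Re (deriv (chain T t) z / \<kappa> z)"
proof -
  have "(chain T t has_field_derivative
      deriv T z + of_real t * (\<kappa> z + z * deriv \<kappa> z)) (at z)"
    unfolding chain_def[abs_def]
    by (rule derivative_eq_intros refl holomorphic_derivI[OF T open_ball z]
        holomorphic_derivI[OF hol open_ball z])+ (simp add: algebra_simps)
  then have "deriv (chain T t) z / \<kappa> z
      = deriv T z / \<kappa> z + of_real t * (1 + z * deriv \<kappa> z / \<kappa> z)"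
    using nonzero[OF z] by (simp add: DERIV_imp_deriv field_simps)
  have "Re (deriv (chain T t) z / \<kappa> z)
      = Re (deriv T z / \<kappa> z) + t * Re (1 + z * deriv \<kappa> z / \<kappa> z)"
    by (simp only: \<open>deriv (chain T t) z / \<kappa> z = _\<close> plus_complex.sel times_complex.sel Re_complex_of_real Im_complex_of_real)
  moreover have "0 \<le> t * Re (1 + z * deriv \<kappa> z / \<kappa> z)"
    by (rule mult_nonneg_nonneg[OF \<open>0 \<le> t\<close> less_imp_le[OF pos[OF z]]])
  ultimately show ?thesis
    using pos_T[OF z] by linarith
qed

lemma chain_avoids:
  assumes "0 \<le> s" "s \<le> t" and \<zeta>: "\<zeta> \<in> ball 0 1" and z: "cmod z \<le> cmod \<zeta>" "z \<noteq> \<zeta>"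
  shows "chain T s z \<noteq> chain T t \<zeta>"
proof -
  have "chain T t \<zeta> = chain T s \<zeta> + of_real (t - s) * (\<zeta> * \<kappa> \<zeta>)"
    by (simp add: chain_def algebra_simps)
  then show ?thesis
    using ray_avoids[OF chain_hol chain_pos[OF \<open>0 \<le> s\<close>] \<zeta> z, of "t - s"] \<open>s \<le> t\<close> by simp
qed

lemma chain_inj:
  assumes "0 \<le> t"
  shows "inj_on (chain T t) (ball 0 1)"
proof (rule inj_onI, rule ccontr)
  fix z w assume *: "z \<in> ball 0 1" "w \<in> ball 0 1" "chain T t z = chain T t w" "z \<noteq> w"
  then show False
    using chain_avoids[OF assms order_refl, of z w] chain_avoids[OF assms order_refl, of w z]
    by (metis linear)
qed

text \<open>On a disc of radius \<open>r < 1\<close>, the frontier of the image under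
  \<open>chain T t\<close> comes from the circle, whose values \<open>chain T s\<close> avoids on
  the open disc. The image under \<open>chain T s\<close> is connected and shares the value at the
  origin, so it cannot leave.\<close>

lemma chain_image_mono:
  assumes "0 \<le> s" "s \<le> t"
  shows "chain T s ` ball 0 1 \<subseteq> chain T t ` ball 0 1"
proof
  fix y assume "y \<in> chain T s ` ball 0 1"
  then obtain z where z: "cmod z < 1" "y = chain T s z" by auto
  obtain r where r: "cmod z < r" "r < 1" using dense z by blast
  define M where "M = chain T t ` cball 0 r"
  have sub: "cball 0 r \<subseteq> ball (0::complex) 1" "ball 0 r \<subseteq> ball (0::complex) 1"
    using r by auto
  have "compact M"
    unfolding M_def by (intro compact_continuous_image continuous_on_subset[OF _ sub(1)]
        holomorphic_on_imp_continuous_on chain_hol) auto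
  have "open (chain T t ` ball 0 r)"
    by (rule open_mapping_thm3[OF holomorphic_on_subset[OF chain_hol sub(2)] open_ball
          inj_on_subset[OF chain_inj sub(2)]]) (use assms in auto)
  have front: "frontier M \<subseteq> chain T t ` sphere 0 r"
  proof
    fix c assume c: "c \<in> frontier M"
    then have "c \<in> M"
      using \<open>compact M\<close> compact_imp_closed frontier_subset_closed by blast
    then obtain \<zeta> where \<zeta>: "\<zeta> \<in> cball 0 r" "c = chain T t \<zeta>" by (auto simp: M_def)
    have "c \<notin> chain T t ` ball 0 r"
    proof
      assume "c \<in> chain T t ` ball 0 r"
      moreover have "chain T t ` ball 0 r \<subseteq> M" unfolding M_def by auto
      ultimately have "c \<in> interior M" using \<open>open (chain T t ` ball 0 r)\<close> by (metis interiorI)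
      then show False using c by (simp add: frontier_def)
    qed
    then have "cmod \<zeta> = r" using \<zeta> by force
    then show "c \<in> chain T t ` sphere 0 r" using \<zeta> by auto
  qed
  have "y \<in> M"
  proof (rule ccontr)
    assume "y \<notin> M"
    have "chain T s 0 = chain T t 0" by (simp add: chain_def)
    then have "chain T s ` ball 0 r \<inter> M \<noteq> {}"
      using order.strict_trans1[OF norm_ge_zero r(1)] unfolding M_def
      by (intro ex_in_conv[THEN iffD1] exI[of _ "chain T s 0"] IntI) (auto intro: image_eqI[of _ _ 0])
    moreover have "y \<in> chain T s ` ball 0 r - M"
      using z r \<open>y \<notin> M\<close> by simp
    moreover have "connected (chain T s ` ball 0 r)"
      by (intro connected_continuous_image continuous_on_subset[OF _ sub(2)]
          holomorphic_on_imp_continuous_on chain_hol) auto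
    ultimately have "chain T s ` ball 0 r \<inter> frontier M \<noteq> {}"
      by (intro connected_Int_frontier) auto
    then obtain c where c: "c \<in> chain T s ` ball 0 r" "c \<in> chain T t ` sphere 0 r"
      using front by blast
    obtain z' where z': "z' \<in> ball 0 r" "c = chain T s z'" using c(1) by (rule imageE)
    obtain \<zeta> where \<zeta>: "\<zeta> \<in> sphere 0 r" "c = chain T t \<zeta>" using c(2) by (rule imageE)
    have "chain T s z' \<noteq> chain T t \<zeta>"
      by (rule chain_avoids[OF assms]) (use z' \<zeta> r in auto)
    then show False
      using z' \<zeta> by simp
  qed
  then show "y \<in> chain T t ` ball 0 1" using sub by (auto simp: M_def)
qed

text \<open>The larger map is univalent, so its inverse turns the inclusion of images into
  subordination; \<open>v 0 = 0\<close> because all members agree at the origin.\<close>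

lemma chain_subordinate:
  assumes "0 \<le> s" "s \<le> t"
  obtains v where "v holomorphic_on ball 0 1" "v ` ball 0 1 \<subseteq> ball 0 1" "v 0 = 0"
    "\<And>z. z \<in> ball 0 1 \<Longrightarrow> chain T s z = chain T t (v z)"
proof -
  have "inj_on (chain T t) (ball 0 1)" using chain_inj assms by simp
  then obtain g where g: "g holomorphic_on chain T t ` ball 0 1"
      "\<And>z. z \<in> ball 0 1 \<Longrightarrow> g (chain T t z) = z"
    using holomorphic_has_inverse[OF chain_hol open_ball] by metis
  note sub = chain_image_mono[OF assms]
  have *: "g (chain T s z) \<in> ball 0 1 \<and> chain T s z = chain T t (g (chain T s z))"
    if "z \<in> ball 0 1" for z
  proof -
    have "chain T s z \<in> chain T t ` ball 0 1" using sub that by (rule subsetD[OF _ imageI])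
    then obtain z' where z': "z' \<in> ball 0 1" "chain T s z = chain T t z'" by (rule imageE)
    then show ?thesis using g(2)[OF z'(1)] by simp
  qed
  show thesis
  proof (rule that[of "\<lambda>z. g (chain T s z)"])
    show "(\<lambda>z. g (chain T s z)) holomorphic_on ball 0 1"
      using holomorphic_on_compose_gen[OF chain_hol g(1) sub] by (simp add: o_def)
    show "g (chain T s 0) = 0"
      using g(2)[of 0] by (simp add: chain_def)
  qed (use * in auto)
qed

end

end

section \<open>Jack's lemma and contact points\<close>

text \<open>On the circle through \<open>z\<close> the real part of \<open>v\<close> times
  \<open>cnj (v z)\<close> is maximal at \<open>z\<close>, so its angular derivative vanishes and
  the quotient \<open>m\<close> is real. Along the radius Schwarz's lemma bounds \<open>v\<close>
  linearly, which forces \<open>m\<close> to be at least 1.\<close>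

lemma Jack_lemma:
  assumes v: "v holomorphic_on ball 0 R" "v 0 = 0" and z: "z \<in> ball 0 R" "v z \<noteq> 0"
    and max: "\<And>w. cmod w \<le> cmod z \<Longrightarrow> cmod (v w) \<le> cmod (v z)"
  obtains m :: real where "1 \<le> m" "z * deriv v z = of_real m * v z"
proof -
  define c where "c = z * deriv v z * cnj (v z)"
  have dv: "(v has_field_derivative deriv v z) (at z)"
    using holomorphic_derivI[OF v(1) open_ball z(1)] .
  have dvc: "((\<lambda>w. v w * cnj (v z)) has_field_derivative deriv v z * cnj (v z)) (at z)"
    using dv by (rule DERIV_cmult_right)
  have le: "Re (v w * cnj (v z)) \<le> cmod (v w) * cmod (v z)" for w
    using complex_Re_le_cmod[of "v w * cnj (v z)"] by (simp add: norm_mult)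
  have eq: "Re (v z * cnj (v z)) = cmod (v z) * cmod (v z)"
    by (simp add: cmod_power2 flip: power2_eq_square)
  have "Im c = 0"
  proof -
    have "((\<lambda>x. Re (v (z * cis x) * cnj (v z))) has_real_derivative
        Re (\<i> * (z * cis 0) * (deriv v z * cnj (v z)))) (at 0)"
      by (rule has_real_derivative_Re_on_circle) (use dvc in simp)
    moreover have "\<forall>y. \<bar>0 - y\<bar> < 1 \<longrightarrow>
        Re (v (z * cis y) * cnj (v z)) \<le> Re (v (z * cis 0) * cnj (v z))"
    proof (intro allI impI)
      fix y :: real
      have "Re (v (z * cis y) * cnj (v z)) \<le> cmod (v (z * cis y)) * cmod (v z)" by (rule le)
      also have "\<dots> \<le> cmod (v z) * cmod (v z)"
        by (intro mult_right_mono max) (simp_all add: norm_mult)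
      finally show "Re (v (z * cis y) * cnj (v z)) \<le> Re (v (z * cis 0) * cnj (v z))"
        using eq by simp
    qed
    ultimately have "Re (\<i> * (z * cis 0) * (deriv v z * cnj (v z))) = 0"
      by (rule DERIV_local_max[OF _ zero_less_one])
    moreover have "\<i> * (z * cis 0) * (deriv v z * cnj (v z)) = \<i> * c"
      by (simp add: c_def)
    ultimately have "Re (\<i> * c) = 0" by (simp only:)
    then show ?thesis by simp
  qed
  have Schwarz: "cmod (v (of_real x * z)) \<le> x * cmod (v z)" if "0 \<le> x" "x < 1" for x
  proof -
    define f where "f w = v (w * z) / v z" for w
    have f_le: "cmod (f w) \<le> 1" if "cmod w < 1" for w
      using max[of "w * z"] z(2) mult_left_le_one_le[of "cmod z" "cmod w"] that
      by (simp add: f_def norm_divide norm_mult)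
    have f_hol: "f holomorphic_on ball 0 1"
    proof -
      have "(\<lambda>w. w * z) ` ball 0 1 \<subseteq> ball 0 R"
      proof (clarsimp simp: norm_mult)
        fix w :: complex assume "cmod w < 1"
        then show "cmod w * cmod z < R"
          using z(1) mult_left_le_one_le[of "cmod z" "cmod w"] by simp
      qed
      then have "(\<lambda>w. v (w * z)) holomorphic_on ball 0 1"
        using holomorphic_on_compose_gen[of "\<lambda>w. w * z" "ball 0 1" v "ball 0 R"] v(1)
        by (simp add: o_def holomorphic_intros)
      then show ?thesis unfolding f_def by (intro holomorphic_intros) (use z in auto)
    qed
    \<comment> \<open>\<open>Schwarz_Lemma\<close> asks for values strictly inside the disc, whereas
      \<open>f\<close> is only bounded by 1; the factor \<open>s < 1\<close> makes up for this and
      is removed in the limit.\<close>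
    have "cmod (f w) \<le> cmod w" if w: "cmod w < 1" for w
    proof (rule field_le_mult_one_interval)
      fix s :: real assume s: "0 < s" "s < 1"
      have "cmod (of_real s * f w) \<le> cmod w"
      proof (rule Schwarz_Lemma(1)[OF _ _ _ w])
        show "(\<lambda>w. of_real s * f w) holomorphic_on ball 0 1"
          by (intro holomorphic_intros f_hol)
        show "cmod (of_real s * f u) < 1" if "cmod u < 1" for u
proof -
          have "cmod (of_real s * f u) = s * cmod (f u)" using s by (simp add: norm_mult)
          also have "\<dots> \<le> s * 1"
            using f_le[OF that] s by (intro mult_left_mono) auto
          finally show ?thesis using s by simp
        qed
      qed (simp add: f_def v(2))
      then show "s * cmod (f w) \<le> cmod w" using s by (simp add: norm_mult)
    qed
    from this[of "of_real x"] show ?thesis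
      using that z(2) by (simp add: f_def norm_divide divide_le_eq)
  qed
  \<comment> \<open>\<open>\<psi>\<close> is at most 0 on the interval from 0 to 1 and vanishes at
    1, so its derivative at 1 cannot be negative.\<close>
  define \<psi> where "\<psi> x = Re (v (of_real x * z) * cnj (v z)) - x * (cmod (v z))\<^sup>2" for x :: real
  have "((\<lambda>x. of_real x * z) has_vector_derivative z) (at 1)"
    by (auto intro!: derivative_eq_intros has_vector_derivative_real_field)
  from field_vector_diff_chain_at[OF this, of "\<lambda>w. v w * cnj (v z)" "deriv v z * cnj (v z)"] dvc
  have "((\<lambda>x. v (of_real x * z) * cnj (v z)) has_vector_derivative c) (at 1)"
    by (simp add: o_def c_def mult.assoc)
  then have "((\<lambda>x. Re (v (of_real x * z) * cnj (v z))) has_real_derivative Re c) (at 1)"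
    by (rule has_field_derivative_Re)
  then have d\<psi>: "(\<psi> has_real_derivative Re c - (cmod (v z))\<^sup>2) (at 1)"
    unfolding \<psi>_def[abs_def] by (rule DERIV_diff) (auto intro!: derivative_eq_intros)
  have "(cmod (v z))\<^sup>2 \<le> Re c"
  proof (rule ccontr)
    assume "\<not> ?thesis"
    then obtain d where d: "0 < d" "\<And>h. 0 < h \<Longrightarrow> h < d \<Longrightarrow> \<psi> 1 < \<psi> (1 - h)"
      using DERIV_neg_dec_left[OF d\<psi>] by auto
    define x where "x = 1 - min (d/2) (1/2)"
    have x: "0 \<le> x" "x < 1" "\<psi> 1 < \<psi> x"
      using d(1) d(2)[of "min (d/2) (1/2)"] by (auto simp: x_def)
    have "\<psi> x \<le> cmod (v (of_real x * z)) * cmod (v z) - x * (cmod (v z))\<^sup>2"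
      using le[of "of_real x * z"] by (simp add: \<psi>_def)
    also have "\<dots> \<le> x * cmod (v z) * cmod (v z) - x * (cmod (v z))\<^sup>2"
      using mult_right_mono[OF Schwarz[OF x(1,2)], of "cmod (v z)"] by simp
    also have "\<dots> = \<psi> 1"
      using eq by (simp add: \<psi>_def power2_eq_square)
    finally show False using x by simp
  qed
  moreover have c: "c = of_real (Re c)"
    using \<open>Im c = 0\<close> by (simp add: complex_eq_iff)
  ultimately have m: "1 \<le> Re c / (cmod (v z))\<^sup>2"
    using z(2) by simp
  moreover have "z * deriv v z = of_real (Re c / (cmod (v z))\<^sup>2) * v z"
  proof -
    have "z * deriv v z * (v z * cnj (v z)) = of_real (Re c) * v z"
      using c by (simp add: c_def mult_ac)
    then show ?thesis
      using z(2) by (simp add: complex_norm_square[symmetric] field_simps)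
  qed
  ultimately show thesis by (rule that)
qed

text \<open>The inverse of \<open>q\<close> pulls \<open>p\<close> back to a function \<open>v\<close> with \<open>v 0 = 0\<close>. At a point where
  \<open>\<bar>v\<bar>\<close> exceeds the modulus of its argument and is maximal on the disc up to that point, Jack's
  lemma yields a contact of the excluded kind.\<close>

lemma subordination_principle:
  assumes p: "p holomorphic_on ball 0 1" and q: "q holomorphic_on ball 0 1" "inj_on q (ball 0 1)"
    and "p 0 = q 0"
    and no_contact: "\<And>R z \<zeta> m. 0 < R \<Longrightarrow> R \<le> 1 \<Longrightarrow> p ` ball 0 R \<subseteq> q ` ball 0 1 \<Longrightarrow>
      z \<in> ball 0 R \<Longrightarrow> \<zeta> \<in> ball 0 1 \<Longrightarrow> cmod z < cmod \<zeta> \<Longrightarrow> z \<noteq> 0 \<Longrightarrow> p z = q \<zeta> \<Longrightarrow>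
      1 \<le> m \<Longrightarrow> z * deriv p z = of_real m * (\<zeta> * deriv q \<zeta>) \<Longrightarrow> False"
  shows "\<exists>w. w holomorphic_on ball 0 1 \<and> w ` ball 0 1 \<subseteq> ball 0 1 \<and> w 0 = 0 \<and>
    (\<forall>z\<in>ball 0 1. p z = q (w z))"
proof -
  obtain g where g: "g holomorphic_on q ` ball 0 1" "\<And>z. z \<in> ball 0 1 \<Longrightarrow> g (q z) = z"
    using holomorphic_has_inverse[OF q(1) open_ball q(2)] by metis
  have opq: "open (q ` ball 0 1)"
    by (rule open_mapping_thm3[OF q(1) open_ball q(2)])
  have gq: "g u \<in> ball 0 1" "q (g u) = u" if "u \<in> q ` ball 0 1" for u
    using that g(2) by auto
  have v0: "g (p 0) = 0" using g(2)[of 0] \<open>p 0 = q 0\<close> by simp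
  \<comment> \<open>This is proved on every disc that \<open>p\<close> maps into the image of
    \<open>q\<close>, because the inclusion for the whole disc is deduced from it.\<close>
  have bound: "cmod (g (p z1)) \<le> cmod z1"
    if R: "0 < R" "R \<le> 1" and im: "p ` ball 0 R \<subseteq> q ` ball 0 1" and z1: "z1 \<in> ball 0 R" for R z1
  proof (rule ccontr)
    assume gt: "\<not> ?thesis"
    define v where "v z = g (p z)" for z
    have p_R: "p holomorphic_on ball 0 R"
      by (rule holomorphic_on_subset[OF p]) (use R in auto)
    have v_hol: "v holomorphic_on ball 0 R"
      using holomorphic_on_compose_gen[OF p_R g(1) im] by (simp add: v_def[abs_def] o_def)
    have "continuous_on (cball 0 (cmod z1)) (\<lambda>z. cmod (v z))"
      by (intro continuous_on_norm continuous_on_subset[OF holomorphic_on_imp_continuous_on[OF v_hol]])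
        (use z1 in auto)
    from continuous_attains_sup[OF _ _ this]
    obtain z0 where z0: "cmod z0 \<le> cmod z1" and max: "\<And>y. cmod y \<le> cmod z1 \<Longrightarrow> cmod (v y) \<le> cmod (v z0)"
      by (auto simp: mem_cball_0)
    have z0R: "z0 \<in> ball 0 R" using z0 z1 by auto
    have lt: "cmod z0 < cmod (v z0)"
      using max[of z1] gt z0 by (simp add: v_def)
    then have "v z0 \<noteq> 0" by auto
    then have "z0 \<noteq> 0" using v0 by (auto simp: v_def)
    obtain m where m: "1 \<le> m" "z0 * deriv v z0 = of_real m * v z0"
      by (rule Jack_lemma[OF v_hol _ z0R \<open>v z0 \<noteq> 0\<close>]) (use v0 max z0 in \<open>auto simp: v_def\<close>)
    have vb: "v z \<in> ball 0 1" "q (v z) = p z" if "z \<in> ball 0 R" for z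
      using im that gq unfolding v_def by blast+
    have "deriv p z0 = deriv q (v z0) * deriv v z0"
    proof (rule DERIV_imp_deriv)
      have "((\<lambda>z. q (v z)) has_field_derivative deriv q (v z0) * deriv v z0) (at z0)"
        by (rule DERIV_chain2[OF holomorphic_derivI[OF q(1) open_ball vb(1)[OF z0R]]
              holomorphic_derivI[OF v_hol open_ball z0R]])
      then show "(p has_field_derivative deriv q (v z0) * deriv v z0) (at z0)"
        by (rule has_field_derivative_transform_within_open[OF _ open_ball z0R]) (rule vb)
    qed
    then have "z0 * deriv p z0 = of_real m * (v z0 * deriv q (v z0))"
      using m(2) by (simp add: mult_ac)
    then show False
      using no_contact[OF R im z0R vb(1)[OF z0R] lt \<open>z0 \<noteq> 0\<close> vb(2)[OF z0R, symmetric] m(1)] by blast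
  qed
  have im: "p ` ball 0 1 \<subseteq> q ` ball 0 1"
  proof (rule ccontr)
    assume "\<not> ?thesis"
    then obtain z1 where z1: "z1 \<in> ball 0 1" "p z1 \<notin> q ` ball 0 1" by blast
    define B where "B = {z \<in> cball 0 (cmod z1). p z \<in> - q ` ball 0 1}"
    have p_cont: "continuous_on (cball 0 (cmod z1)) p"
      by (rule continuous_on_subset[OF holomorphic_on_imp_continuous_on[OF p]]) (use z1 in auto)
    have "closed B"
      unfolding B_def
      using continuous_closed_preimage[OF p_cont closed_cball, of "- q ` ball 0 1"] opq
      by (simp add: vimage_def Int_def closed_Compl)
    moreover have "B \<subseteq> cball 0 (cmod z1)" by (auto simp: B_def)
    ultimately have "compact B" by (metis compact_cball compact_Int_closed inf.absorb_iff2)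
    moreover have "z1 \<in> B" using z1 by (simp add: B_def)
    ultimately obtain z2 where z2: "z2 \<in> B" "\<And>z. z \<in> B \<Longrightarrow> cmod z2 \<le> cmod z"
      using continuous_attains_inf[of B cmod] continuous_on_norm_id by blast
    define R where "R = cmod z2"
    have "z2 \<noteq> 0" using z2(1) \<open>p 0 = q 0\<close> by (auto simp: B_def)
    then have R: "0 < R" "R < 1" using z2(1) z1 by (auto simp: R_def B_def)
    have imR: "p ` ball 0 R \<subseteq> q ` ball 0 1"
    proof (rule ccontr)
      assume "\<not> ?thesis"
      then obtain z where "z \<in> ball 0 R" "p z \<notin> q ` ball 0 1" by blast
      moreover have "cmod z2 \<le> cmod z1" using z2(1) by (simp add: B_def)
      ultimately show False using z2(2)[of z] by (simp add: B_def R_def)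
    qed
    have "compact (q ` cball 0 R)"
      by (intro compact_continuous_image continuous_on_subset[OF holomorphic_on_imp_continuous_on[OF q(1)]])
        (use R in auto)
    moreover have "p ` ball 0 R \<subseteq> q ` cball 0 R"
    proof
      fix u assume "u \<in> p ` ball 0 R"
      then obtain z where z: "z \<in> ball 0 R" "u = p z" by auto
      then have "cmod (g u) \<le> R" using bound[OF R(1) _ imR z(1)] R by simp
      moreover have "q (g u) = u" using gq(2) imR z by blast
      ultimately show "u \<in> q ` cball 0 R" by (metis image_eqI mem_cball_0)
    qed
    moreover have "continuous_on (closure (ball 0 R)) p"
      using R by (intro continuous_on_subset[OF holomorphic_on_imp_continuous_on[OF p]]) auto
    ultimately have "p ` closure (ball 0 R) \<subseteq> q ` cball 0 R"
      by (intro image_closure_subset compact_imp_closed)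
    then have "p z2 \<in> q ` cball 0 R" using R by (auto simp: R_def)
    then show False using z2(1) R by (auto simp: B_def)
  qed
  have "(\<lambda>z. g (p z)) holomorphic_on ball 0 1"
    using holomorphic_on_compose_gen[OF p g(1) im] by (simp add: o_def)
  moreover have "g (p z) \<in> ball 0 1 \<and> p z = q (g (p z))" if "z \<in> ball 0 1" for z
    using gq[of "p z"] im that by (metis image_subset_iff)
  ultimately show ?thesis
    using v0 by (intro exI[of _ "\<lambda>z. g (p z)"]) (auto simp del: mem_ball_0)
qed

section \<open>Principal powers\<close>

text \<open>Logarithmic differentiation of \<open>z g' / g\<close> expresses
  \<open>1 + z g'' / g'\<close> through \<open>zlogderiv g\<close> alone, so \<open>g\<close> itself
  disappears from the problem.\<close>

lemma affine_comb_eq: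
  assumes g: "g \<in> class_A" and ne: "\<And>z. z \<in> unit_disc \<Longrightarrow> zlogderiv g z \<noteq> 0" and z: "z \<in> unit_disc"
  shows "affine_comb l g z = zlogderiv g z + l * (z * deriv (zlogderiv g) z / zlogderiv g z)"
proof (cases "z = 0")
  case True
  then show ?thesis by (simp add: affine_comb_def zlogderiv_def)
next
  case False
  have hol: "g holomorphic_on unit_disc" using g by (simp add: class_A_def class_H_def)
  have nz: "g z \<noteq> 0" "deriv g z \<noteq> 0"
    using ne[OF z] False by (auto simp: zlogderiv_def)
  have "((\<lambda>w. w * deriv g w / g w) has_field_derivative
      ((1 * deriv g z + deriv (deriv g) z * z) * g z - z * deriv g z * deriv g z) / (g z * g z)) (at z)"
    by (intro DERIV_divide DERIV_mult DERIV_ident holomorphic_derivI[OF hol open_ball z]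
        holomorphic_derivI[OF holomorphic_deriv[OF hol open_ball] open_ball z] nz)
  then have "(zlogderiv g has_field_derivative
      ((1 * deriv g z + deriv (deriv g) z * z) * g z - z * deriv g z * deriv g z) / (g z * g z)) (at z)"
    by (rule has_field_derivative_transform_within_open[of _ _ _ "- {0}"])
      (use False in \<open>auto simp: zlogderiv_def\<close>)
  then show ?thesis
    using nz False by (simp add: DERIV_imp_deriv affine_comb_def zlogderiv_def field_simps)
qed

text \<open>Near the origin the principal powers behave like powers of positive numbers. Globally, such
  identities then follow by analytic continuation.\<close>

lemma powr_identity_near_0:
  fixes X Y X' Y' :: "complex \<Rightarrow> complex" and a b c :: complex
  assumes cont: "isCont X 0" "isCont Y 0" "isCont X' 0" "isCont Y' 0"
    and one: "X 0 = 1" "Y 0 = 1" "X' 0 = 1" "Y' 0 = 1"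
    and eq: "\<forall>\<^sub>F z in nhds 0. X z powr a * Y z powr b = X' z powr a * Y' z powr b"
  shows "\<forall>\<^sub>F z in nhds 0. X z powr (c * a) * Y z powr (c * b) = X' z powr (c * a) * Y' z powr (c * b)"
proof -
  \<comment> \<open>\<open>D\<close> compares logarithms of the two sides. It is continuous at 0
    with \<open>D 0 = 0\<close>, so nearby its imaginary part stays below \<open>2 * pi\<close> and
    equal exponentials force equal logarithms.\<close>
  define D where "D z = (a * Ln (X z) + b * Ln (Y z)) - (a * Ln (X' z) + b * Ln (Y' z))" for z
  have "isCont D 0"
    unfolding D_def by (intro continuous_intros cont) (simp_all add: one)
  then have "((\<lambda>z. \<bar>Im (D z)\<bar>) \<longlongrightarrow> \<bar>Im (D 0)\<bar>) (nhds 0)"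
    unfolding isCont_def tendsto_at_iff_tendsto_nhds by (intro tendsto_intros)
  then have ev: "\<forall>\<^sub>F z in nhds 0. \<bar>Im (D z)\<bar> < 2 * pi"
    by (rule order_tendstoD) (simp add: D_def one)
  have nz: "\<forall>\<^sub>F z in nhds 0. f z \<noteq> 0" if "isCont f 0" "f 0 = 1" for f :: "complex \<Rightarrow> complex"
    using that tendsto_imp_eventually_ne[of f 1 "nhds 0" 0] tendsto_at_iff_tendsto_nhds[of f 0]
    by (simp add: isCont_def)
  show ?thesis
    using eq ev nz[OF cont(1) one(1)] nz[OF cont(2) one(2)] nz[OF cont(3) one(3)] nz[OF cont(4) one(4)]
  proof eventually_elim
    case (elim z)
    have powr: "X z powr (k * a) * Y z powr (k * b) = exp (k * (a * Ln (X z) + b * Ln (Y z)))"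
      "X' z powr (k * a) * Y' z powr (k * b) = exp (k * (a * Ln (X' z) + b * Ln (Y' z)))" for k
      using elim by (simp_all add: powr_def exp_add ring_distribs mult_ac)
    have "a * Ln (X z) + b * Ln (Y z) = a * Ln (X' z) + b * Ln (Y' z)"
    proof (rule exp_complex_eqI)
      show "exp (a * Ln (X z) + b * Ln (Y z)) = exp (a * Ln (X' z) + b * Ln (Y' z))"
        using elim(1) powr[of 1] by (simp only: mult_1)
      show "\<bar>Im (a * Ln (X z) + b * Ln (Y z)) - Im (a * Ln (X' z) + b * Ln (Y' z))\<bar> < 2 * pi"
        using elim(2) by (simp only: D_def minus_complex.sel)
    qed
    then show ?case by (simp only: powr)
  qed
qed

text \<open>For an exponent strictly between 0 and 1 the principal power jumps across the negative
  axis. A nonconstant \<open>A\<close> is open, so on reaching the slit it would make that jump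
  visible in the composition.\<close>

lemma holomorphic_powr_imp_slit:
  assumes A: "A holomorphic_on ball 0 1" "A 0 = 1" and \<mu>: "0 < \<mu>" "\<mu> < 1"
    and U: "(\<lambda>z. A z powr of_real \<mu>) holomorphic_on ball 0 1" and z: "z \<in> ball 0 1"
  shows "A z \<notin> \<real>\<^sub>\<le>\<^sub>0"
proof
  assume neg: "A z \<in> \<real>\<^sub>\<le>\<^sub>0"
  have nonconst: "\<not> A constant_on ball 0 1"
  proof
    assume "A constant_on ball 0 1"
    then have "A z = A 0" using z by (auto simp: constant_on_def)
    then show False using neg A(2) by simp
  qed
  have op: "open (A ` V)" if "open V" "V \<subseteq> ball 0 1" for V
    by (rule open_mapping_thm[OF A(1) open_ball connected_ball that nonconst])
  obtain e where e: "e > 0" "ball (A z) e \<subseteq> A ` ball 0 1"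
    using op[OF open_ball order_refl] z by (metis image_eqI open_contains_ball)
  obtain x0 where x0: "x0 \<le> 0" "A z = of_real x0" using neg by (auto elim: nonpos_Reals_cases)
  \<comment> \<open>\<open>A z\<close> may be 0, where the power does not jump; a shift to the left
    by \<open>e / 2\<close> gives a strictly negative value of \<open>A\<close>.\<close>
  define x where "x = e / 2 - x0"
  have "x > 0" using e x0 by (simp add: x_def)
  have "- of_real x \<in> ball (A z) e"
    using e x0 by (simp add: x_def dist_norm)
  then obtain z1 where z1: "z1 \<in> ball 0 1" "A z1 = - of_real x" using e by (metis imageE subsetD)
  \<comment> \<open>\<open>V\<close> continues the power across the slit from below, with argument
    \<open>- pi\<close> on it. It differs from the principal power at \<open>z1\<close> but equals
    it where \<open>A\<close> is just below the slit.\<close>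
  define V where "V w = exp (of_real \<mu> * (Ln (- A w) - \<i> * of_real pi))" for w
  have contA: "isCont A z1"
    using holomorphic_on_imp_continuous_on[OF A(1)] z1(1) by (simp add: continuous_on_eq_continuous_at)
  have contV: "isCont V z1"
    unfolding V_def using z1 \<open>x > 0\<close> by (intro continuous_intros contA) auto
  have contU: "isCont (\<lambda>z. A z powr of_real \<mu>) z1"
    using holomorphic_on_imp_continuous_on[OF U] z1(1) by (simp add: continuous_on_eq_continuous_at)
  have "A z1 powr of_real \<mu> - V z1 \<noteq> 0"
  proof
    have "Ln (A z1) = of_real (ln x) + \<i> * of_real pi"
      using \<open>x > 0\<close> Ln_minus[of "of_real x"] by (simp add: z1(2) Ln_of_real)
    moreover assume "A z1 powr of_real \<mu> - V z1 = 0"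
    ultimately have eq: "exp (of_real \<mu> * (of_real (ln x) + \<i> * of_real pi))
        = exp (of_real \<mu> * (of_real (ln x) - \<i> * of_real pi))"
      using \<open>x > 0\<close> by (simp add: V_def z1(2) powr_def Ln_of_real)
    have "of_real \<mu> * (of_real (ln x) + \<i> * of_real pi) = of_real \<mu> * (of_real (ln x) - \<i> * of_real pi)"
      by (rule exp_complex_eqI[OF _ eq]) (use \<mu> in \<open>simp add: abs_mult\<close>)
    then show False using \<mu> by (simp add: complex_eq_iff)
  qed
  then obtain d where d: "d > 0" "\<And>w. dist z1 w < d \<Longrightarrow> A w powr of_real \<mu> - V w \<noteq> 0"
    using continuous_at_avoid[OF isCont_diff[OF contU contV]] by blast
  have "open (A ` (ball z1 d \<inter> ball 0 1))" by (rule op) auto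
  moreover have "A z1 \<in> A ` (ball z1 d \<inter> ball 0 1)"
    by (rule imageI) (use d z1 in auto)
  ultimately obtain r where r: "r > 0" "ball (A z1) r \<subseteq> A ` (ball z1 d \<inter> ball 0 1)"
    by (metis open_contains_ball)
  have "A z1 - \<i> * of_real (r / 2) \<in> ball (A z1) r"
    using r by (simp add: dist_norm norm_mult)
  with r(2) have "A z1 - \<i> * of_real (r / 2) \<in> A ` (ball z1 d \<inter> ball 0 1)"
    by (rule subsetD)
  then obtain w where w: "dist z1 w < d" "A w = A z1 - \<i> * of_real (r / 2)"
    by (elim imageE) (metis IntD1 mem_ball)
  have "Im (A w) < 0" using w z1 r by simp
  then have "Ln (A w) = Ln (- A w) - \<i> * of_real pi"
    using Ln_minus[of "- A w"] by (auto simp: complex_eq_iff)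
  moreover have "A w \<noteq> 0" using \<open>Im (A w) < 0\<close> by auto
  ultimately have "A w powr of_real \<mu> = V w" by (simp add: powr_def V_def)
  then show False using d(2)[OF w(1)] by simp
qed

text \<open>By continuity from a point where \<open>X = Y\<close>, the arguments of \<open>X\<close> and \<open>Y\<close> differ by
  less than \<open>pi\<close>, so the segment between them passes the origin on the side away from the slit.\<close>

lemma segment_avoids_slit:
  fixes X Y :: "complex \<Rightarrow> complex"
  assumes S: "connected S" and cont: "continuous_on S X" "continuous_on S Y"
    and slit: "\<And>z. z \<in> S \<Longrightarrow> X z \<notin> \<real>\<^sub>\<le>\<^sub>0" "\<And>z. z \<in> S \<Longrightarrow> Y z \<notin> \<real>\<^sub>\<le>\<^sub>0"
    and z0: "z0 \<in> S" "X z0 = Y z0"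
    and nz: "\<And>z t. z \<in> S \<Longrightarrow> 0 \<le> t \<Longrightarrow> t \<le> 1 \<Longrightarrow> X z + of_real t * (Y z - X z) \<noteq> 0"
    and z: "z \<in> S" and t: "0 \<le> t" "t \<le> 1"
  shows "X z + of_real t * (Y z - X z) \<notin> \<real>\<^sub>\<le>\<^sub>0"
proof
  define \<delta> where "\<delta> w = \<bar>Im (Ln (Y w)) - Im (Ln (X w))\<bar>" for w
  have XY: "X w = of_real (cmod (X w)) * cis (Im (Ln (X w)))" "X w \<noteq> 0"
    "Y w = of_real (cmod (Y w)) * cis (Im (Ln (Y w)))" "Y w \<noteq> 0" if "w \<in> S" for w
  proof -
    show "X w \<noteq> 0" "Y w \<noteq> 0" using slit[OF that] by auto
    then show "X w = of_real (cmod (X w)) * cis (Im (Ln (X w)))"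
      "Y w = of_real (cmod (Y w)) * cis (Im (Ln (Y w)))"
      by (metis Arg_def rcis_cmod_Arg rcis_def)+
  qed
  have bd: "\<bar>Im (Ln u)\<bar> < pi" if "u \<notin> \<real>\<^sub>\<le>\<^sub>0" for u
  proof -
    have "u \<noteq> 0" using that by auto
    moreover have "Im (Ln u) \<noteq> pi"
      using that Im_Ln_eq_pi[OF \<open>u \<noteq> 0\<close>] by (auto simp: complex_nonpos_Reals_iff)
    ultimately show ?thesis using mpi_less_Im_Ln[of u] Im_Ln_le_pi[of u] by linarith
  qed
  have ne_pi: "\<delta> w \<noteq> pi" if "w \<in> S" for w
  proof
    assume "\<delta> w = pi"
    then consider "Im (Ln (Y w)) = Im (Ln (X w)) + pi" | "Im (Ln (Y w)) = Im (Ln (X w)) - pi"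
      unfolding \<delta>_def by linarith
    then have "cis (Im (Ln (Y w))) = - cis (Im (Ln (X w)))"
      by cases (simp_all add: complex_eq_iff)
    then have Y: "Y w = - of_real (cmod (Y w)) * cis (Im (Ln (X w)))"
      using XY(3)[OF that] by simp
    \<comment> \<open>The parameter at which the segment between two opposite vectors passes through
      the origin.\<close>
    define s where "s = cmod (X w) / (cmod (X w) + cmod (Y w))"
    have pos: "0 < cmod (X w)" "0 < cmod (Y w)" using XY[OF that] by auto
    have "X w + of_real s * (Y w - X w)
        = of_real (cmod (X w) - s * (cmod (Y w) + cmod (X w))) * cis (Im (Ln (X w)))"
      by (subst (1 2) XY(1)[OF that], subst Y) (simp add: algebra_simps)
    also have "cmod (X w) - s * (cmod (Y w) + cmod (X w)) = 0"
    proof -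
      have "cmod (X w) + cmod (Y w) \<noteq> 0" using pos by linarith
      then show ?thesis by (simp add: s_def add.commute)
    qed
    finally show False
      using nz[OF that, of s] pos by (simp add: s_def)
  qed
  have "\<delta> z < pi"
  proof (rule ccontr)
    assume "\<not> ?thesis"
    moreover have "\<delta> z0 = 0" using z0 by (simp add: \<delta>_def)
    moreover have "connected (\<delta> ` S)"
      unfolding \<delta>_def by (intro connected_continuous_image continuous_intros S cont) (use slit in auto)
    ultimately have "pi \<in> \<delta> ` S"
      using z z0 connectedD_interval[of "\<delta> ` S" 0 "\<delta> z" pi] by (metis imageI linorder_not_less pi_ge_zero)
    then show False using ne_pi by (metis imageE)
  qed
  define x y where "x = Im (Ln (X z))" and "y = Im (Ln (Y z))"
  have b: "\<bar>x\<bar> < pi" "\<bar>y\<bar> < pi" "\<bar>y - x\<bar> < pi"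
    using bd slit z \<open>\<delta> z < pi\<close> by (auto simp: x_def y_def \<delta>_def)
  define A B where "A = (1 - t) * cmod (X z)" and "B = t * cmod (Y z)"
  have AB: "0 \<le> A" "0 \<le> B" using t by (auto simp: A_def B_def)
  define C where "C = X z + of_real t * (Y z - X z)"
  have C: "C = of_real A * cis x + of_real B * cis y"
  proof -
    have "C = of_real (1 - t) * X z + of_real t * Y z" by (simp add: C_def algebra_simps)
    also have "\<dots> = of_real A * cis x + of_real B * cis y"
      by (subst XY(1)[OF z], subst XY(3)[OF z]) (simp add: A_def B_def x_def y_def)
    finally show ?thesis .
  qed
  assume "X z + of_real t * (Y z - X z) \<in> \<real>\<^sub>\<le>\<^sub>0"
  then have neg: "Re C \<le> 0" "Im C = 0" "C \<in> \<real>\<^sub>\<le>\<^sub>0" by (auto simp: C_def complex_nonpos_Reals_iff)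
  have "t \<noteq> 0" "t \<noteq> 1" using neg(3) slit[OF z] by (auto simp: C_def)
  then have AB': "0 < A" "0 < B" using t XY[OF z] by (auto simp: A_def B_def)
  have Im: "A * sin x + B * sin y = 0" and Re: "A * cos x + B * cos y \<le> 0"
    using neg by (auto simp: C)
  \<comment> \<open>\<open>C\<close> is real and nonpositive; taking its components orthogonal to
    \<open>cis y\<close> and to \<open>cis x\<close> leaves one summand each. The resulting signs of
    \<open>sin x\<close> and \<open>sin y\<close> contradict the order of \<open>x\<close> and
    \<open>y\<close>.\<close>
  have rot: "A * sin (y - x) = - (A * cos x + B * cos y) * - sin y"
    "B * sin (y - x) = - (A * cos x + B * cos y) * sin x"
  proof -
    have "A * sin (y - x) = sin y * (A * cos x) - cos y * (A * sin x)"
      by (simp add: sin_diff algebra_simps)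
    also have "A * sin x = - B * sin y" using Im by simp
    finally show "A * sin (y - x) = - (A * cos x + B * cos y) * - sin y"
      by (simp add: algebra_simps)
    have "B * sin (y - x) = cos x * (B * sin y) - sin x * (B * cos y)"
      by (simp add: sin_diff algebra_simps)
    also have "B * sin y = - A * sin x" using Im by simp
    finally show "B * sin (y - x) = - (A * cos x + B * cos y) * sin x"
      by (simp add: algebra_simps)
  qed
  have sin_sgn: "0 < sin u \<longleftrightarrow> 0 < u" "sin u < 0 \<longleftrightarrow> u < 0" if "\<bar>u\<bar> < pi" for u
    using that sin_gt_zero[of u] sin_gt_zero[of "- u"] by (auto simp: abs_less_iff) (smt (verit) sin_zero)+
  show False
  proof (cases "x = y")
    case True
    then have "(A + B) * sin x = 0" "(A + B) * cos x \<le> 0" using Im Re by (auto simp: algebra_simps)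
    then have "sin x = 0" "cos x \<le> 0" using AB' by (auto simp: mult_le_0_iff)
    moreover have "x = 0" using sin_sgn[OF b(1)] \<open>sin x = 0\<close> by linarith
    ultimately show False by simp
  next
    case False
    have "sin (y - x) \<noteq> 0" using sin_sgn[OF b(3)] False by linarith
    define P where "P = - (A * cos x + B * cos y)"
    have P: "0 \<le> P" using Re by (simp add: P_def)
    have r: "A * sin (y - x) = - (P * sin y)" "B * sin (y - x) = P * sin x"
      using rot by (simp_all add: P_def)
    consider "x < y" | "y < x" using False by linarith
    then show False
    proof cases
      case 1
      then have "0 < sin (y - x)" using sin_sgn(1)[OF b(3)] by simp
      then have "0 < P * sin x" "P * sin y < 0"
        using r AB' by (metis mult_pos_pos, metis mult_pos_pos neg_0_less_iff_less)
      then have "0 < sin x" "sin y < 0" using P by (auto simp: zero_less_mult_iff mult_less_0_iff)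
      then show False using 1 sin_sgn b by force
    next
      case 2
      then have "sin (y - x) < 0" using sin_sgn(2)[OF b(3)] by simp
      then have "P * sin x < 0" "0 < P * sin y"
        using r AB' by (metis mult_pos_neg, metis mult_pos_neg neg_less_0_iff_less)
      then have "sin x < 0" "0 < sin y" using P by (auto simp: zero_less_mult_iff mult_less_0_iff)
      then show False using 2 sin_sgn b by force
    qed
  qed
qed

section \<open>The chain attached to a dominant\<close>

text \<open>\<open>q\<close> stands for \<open>zlogderiv g\<close> with either of the two given
  functions, so that one chain serves both the dominant and the subordinant.\<close>

locale power_chain =
  fixes \<alpha> \<mu> :: real and l :: complex and q :: "complex \<Rightarrow> complex"
  assumes params: "0 < \<mu>" "0 < \<alpha> + \<mu>" "l \<noteq> 0"
    and q_univ: "univalent q" and q_0: "q 0 = 1"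
    and q_pos: "\<And>z. z \<in> unit_disc \<Longrightarrow> 0 < Re (1 / l * q z)"
    and q_convex: "\<And>z. z \<in> unit_disc \<Longrightarrow>
      0 < Re (complex_of_real (\<alpha> / \<mu> - 1) * (z * deriv q z / q z) + 1 + z * deriv (deriv q) z / deriv q z)"
begin

text \<open>At \<open>t = 1\<close> this is \<open>affine_comb\<close>. Other values of
  \<open>t\<close> occur at contact points, where Jack's lemma rescales the derivative term by a
  real factor.\<close>

definition C :: "real \<Rightarrow> complex \<Rightarrow> complex" where
  "C t z = q z + of_real t * (l * (z * deriv q z / q z))"

definition H :: "real \<Rightarrow> complex \<Rightarrow> complex" where
  "H t z = q z powr of_real (\<alpha> / \<mu>) * C t z"

section \<open>Holomorphy and nonvanishing of the ingredients\<close>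

lemma q_hol: "q holomorphic_on unit_disc" and q_inj: "inj_on q unit_disc"
  using q_univ by (auto simp: univalent_def)

text \<open>At the origin \<open>q_pos\<close> says \<open>Re (1 / l) > 0\<close>; a real value
  \<open>x\<close> of \<open>q\<close> then satisfies \<open>x * Re (1 / l) > 0\<close> and is
  positive. Hence all principal powers of \<open>q\<close> are holomorphic.\<close>

lemma q_slit: assumes "z \<in> unit_disc" shows "q z \<notin> \<real>\<^sub>\<le>\<^sub>0"
proof
  assume "q z \<in> \<real>\<^sub>\<le>\<^sub>0"
  then obtain x where x: "x \<le> 0" "q z = of_real x" by (auto elim: nonpos_Reals_cases)
  have "0 < Re (1 / l)" using q_pos[of 0] q_0 by simp
  moreover have "0 < Re (1 / l) * x" using q_pos[OF assms] unfolding x(2)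
    by (simp only: times_complex.sel Re_complex_of_real Im_complex_of_real mult_zero_right diff_zero)
  ultimately show False using x(1) by (simp add: zero_less_mult_iff)
qed

lemma q_nz: "z \<in> unit_disc \<Longrightarrow> q z \<noteq> 0"
  using q_slit by force

lemma dq_nz: "z \<in> unit_disc \<Longrightarrow> deriv q z \<noteq> 0"
  by (rule holomorphic_injective_imp_regular[OF q_hol open_ball q_inj])

lemma q_deriv: "z \<in> unit_disc \<Longrightarrow> (q has_field_derivative deriv q z) (at z)"
  by (rule holomorphic_derivI[OF q_hol open_ball])

lemma qpow_deriv:
  assumes "z \<in> unit_disc"
  shows "((\<lambda>z. q z powr b) has_field_derivative b * (q z powr b / q z) * deriv q z) (at z)"
proof -
  have "((\<lambda>z. q z powr b) has_field_derivative b * q z powr (b - 1) * deriv q z) (at z)"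
    by (rule DERIV_chain2[OF has_field_derivative_powr[OF q_slit[OF assms]] q_deriv[OF assms]])
  moreover have "q z powr (b - 1) = q z powr b / q z"
    using q_nz[OF assms] by (simp add: powr_diff)
  ultimately show ?thesis by simp
qed

lemma qpow_hol: "(\<lambda>z. q z powr b) holomorphic_on unit_disc"
  by (intro holomorphic_intros q_hol q_slit)

lemma C_hol: "C t holomorphic_on unit_disc"
  unfolding C_def[abs_def] by (intro holomorphic_intros q_hol q_nz holomorphic_deriv) auto

lemma C_0: "C t 0 = 1"
  by (simp add: C_def q_0)

text \<open>With \<open>b = \<alpha> / \<mu>\<close> this is \<open>l q' q^(b - 1)\<close>, so that
  \<open>z * \<kappa> z\<close> is the coefficient of \<open>t\<close> in \<open>H t\<close>. The
  constant term is \<open>T\<close>, that is \<open>q^(b + 1)\<close>.\<close>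

definition \<kappa> :: "complex \<Rightarrow> complex" where
  "\<kappa> z = l * deriv q z * (q z powr of_real (\<alpha> / \<mu>) / q z)"

definition T :: "complex \<Rightarrow> complex" where
  "T z = q z powr of_real (\<alpha> / \<mu>) * q z"

lemma \<kappa>_hol: "\<kappa> holomorphic_on unit_disc"
  unfolding \<kappa>_def[abs_def] by (intro holomorphic_intros q_hol q_nz q_slit holomorphic_deriv) auto

lemma T_hol: "T holomorphic_on unit_disc"
  unfolding T_def[abs_def] by (intro holomorphic_intros q_hol q_slit)

lemma \<kappa>_nz: "z \<in> unit_disc \<Longrightarrow> \<kappa> z \<noteq> 0"
  using q_nz dq_nz params by (simp add: \<kappa>_def)

text \<open>The logarithmic derivative of \<open>\<kappa>\<close> is
  \<open>q'' / q' + (b - 1) q' / q\<close>, so this is \<open>q_convex\<close> in disguise.\<close>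

lemma \<kappa>_pos:
  assumes z: "z \<in> unit_disc"
  shows "0 < Re (1 + z * deriv \<kappa> z / \<kappa> z)"
proof -
  define b where "b = complex_of_real (\<alpha> / \<mu>)"
  have ddq: "(deriv q has_field_derivative deriv (deriv q) z) (at z)"
    by (rule holomorphic_derivI[OF holomorphic_deriv[OF q_hol open_ball] open_ball z])
  have "(\<kappa> has_field_derivative
      0 * (deriv q z * (q z powr b / q z)) +
      (deriv (deriv q) z * (q z powr b / q z) +
       (b * (q z powr b / q z) * deriv q z * q z - q z powr b * deriv q z) / (q z * q z) * deriv q z) * l) (at z)"
    unfolding \<kappa>_def[abs_def] b_def[symmetric] mult.assoc[of l]
    by (intro DERIV_mult DERIV_divide DERIV_const ddq q_deriv[OF z] qpow_deriv[OF z] q_nz[OF z])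
  moreover have "\<kappa> z = l * deriv q z * (q z powr b / q z)"
    by (simp only: \<kappa>_def b_def)
  ultimately have "deriv \<kappa> z / \<kappa> z = deriv (deriv q) z / deriv q z + (b - 1) * (deriv q z / q z)"
    using q_nz[OF z] dq_nz[OF z] params
    by (simp add: DERIV_imp_deriv field_simps)
  then have "1 + z * deriv \<kappa> z / \<kappa> z
      = of_real (\<alpha> / \<mu> - 1) * (z * deriv q z / q z) + 1 + z * deriv (deriv q) z / deriv q z"
    by (simp add: b_def ring_distribs flip: times_divide_eq_right)
  then show ?thesis using q_convex[OF z] by metis
qed

text \<open>The quotient is \<open>(b + 1) q / l\<close>, and
  \<open>b + 1 = (\<alpha> + \<mu>) / \<mu>\<close> is positive.\<close>

lemma T_pos:
  assumes z: "z \<in> unit_disc"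
  shows "0 < Re (deriv T z / \<kappa> z)"
proof -
  define b where "b = complex_of_real (\<alpha> / \<mu>)"
  have "(T has_field_derivative b * (q z powr b / q z) * deriv q z * q z + deriv q z * q z powr b) (at z)"
    unfolding T_def[abs_def] b_def[symmetric] by (intro DERIV_mult q_deriv[OF z] qpow_deriv[OF z])
  moreover have "\<kappa> z = l * deriv q z * (q z powr b / q z)"
    by (simp only: \<kappa>_def b_def)
  ultimately have "deriv T z / \<kappa> z = (b + 1) * (1 / l * q z)"
    using q_nz[OF z] dq_nz[OF z] params
    by (simp add: DERIV_imp_deriv) (simp add: field_simps)
  also have "b + 1 = of_real (\<alpha> / \<mu> + 1)" by (simp add: b_def)
  also have "\<alpha> / \<mu> + 1 = (\<alpha> + \<mu>) / \<mu>" using params by (simp add: field_simps)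
  finally have "Re (deriv T z / \<kappa> z) = (\<alpha> + \<mu>) / \<mu> * Re (1 / l * q z)"
    by (simp only: times_complex.sel Re_complex_of_real Im_complex_of_real)
  then show ?thesis using q_pos[OF z] params by simp
qed

lemma ex_convex_primitive: "\<exists>K. convex_primitive K \<kappa>"
proof -
  obtain K where "\<And>z. z \<in> unit_disc \<Longrightarrow> (K has_field_derivative \<kappa> z) (at z within unit_disc)"
    using holomorphic_convex_primitive'[OF convex_ball open_ball \<kappa>_hol] by blast
  then have "convex_primitive K \<kappa>"
    using \<kappa>_hol \<kappa>_nz \<kappa>_pos by unfold_locales (auto simp: at_within_open[OF _ open_ball])
  then show ?thesis by (rule exI[of _ K])
qed

text \<open>Fixing one primitive by choice makes the convex theory available as a sublocale.\<close>

definition K where "K = (SOME K. convex_primitive K \<kappa>)"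

sublocale convex_primitive K \<kappa>
  unfolding K_def by (rule someI_ex[OF ex_convex_primitive])

lemma H_eq_chain: "z \<in> unit_disc \<Longrightarrow> H t z = chain T t z"
  using q_nz by (simp add: H_def C_def chain_def T_def \<kappa>_def field_simps)

lemma H_avoids:
  assumes "0 \<le> s" "s \<le> t" and \<zeta>: "\<zeta> \<in> unit_disc" and z: "cmod z < cmod \<zeta>"
  shows "H s z \<noteq> H t \<zeta>"
proof -
  have "z \<in> unit_disc" using z \<zeta> by simp
  then show ?thesis
    using chain_avoids[OF T_hol T_pos assms(1,2) \<zeta>, of z] z H_eq_chain \<zeta> by force
qed

lemma H_subordinate:
  assumes "0 \<le> s" "s \<le> t"
  obtains v where "v holomorphic_on unit_disc" "v ` unit_disc \<subseteq> unit_disc" "v 0 = 0"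
    "\<And>z. z \<in> unit_disc \<Longrightarrow> H s z = H t (v z)"
proof -
  obtain v where v: "v holomorphic_on unit_disc" "v ` unit_disc \<subseteq> unit_disc" "v 0 = 0"
    "\<And>z. z \<in> unit_disc \<Longrightarrow> chain T s z = chain T t (v z)"
    using chain_subordinate[OF T_hol T_pos assms] by blast
  show thesis
  proof (rule that[OF v(1-3)])
    fix z assume "z \<in> unit_disc"
    moreover from this have "v z \<in> unit_disc" using v(2) by (rule subsetD[OF _ imageI, rotated])
    ultimately show "H s z = H t (v z)" using v(4) by (simp add: H_eq_chain)
  qed
qed

text \<open>If \<open>p\<close> touches the image of \<open>q\<close> at \<open>q \<zeta>\<close>, then the expression for \<open>p\<close> is \<open>H m \<zeta>\<close>, which
  the chain keeps away from \<open>H 1\<close> of the smaller disc.\<close>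

lemma dominant:
  assumes p: "p holomorphic_on unit_disc" "p 0 = 1"
    and A: "A holomorphic_on unit_disc" "\<And>z. z \<in> unit_disc \<Longrightarrow> A z = p z + l * (z * deriv p z / p z)"
    and w: "w holomorphic_on unit_disc" "w ` unit_disc \<subseteq> unit_disc" "w 0 = 0"
    and eq: "\<And>z. z \<in> unit_disc \<Longrightarrow>
      p z powr of_real \<alpha> * A z powr of_real \<mu> = q (w z) powr of_real \<alpha> * C 1 (w z) powr of_real \<mu>"
  shows "\<exists>w. w holomorphic_on unit_disc \<and> w ` unit_disc \<subseteq> unit_disc \<and> w 0 = 0 \<and>
    (\<forall>z\<in>unit_disc. p z = q (w z))"
proof (rule subordination_principle[OF p(1) q_hol q_inj])
  show "p 0 = q 0" by (simp add: p q_0)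
  fix R z \<zeta> and m :: real
  assume R: "0 < R" "R \<le> 1" and im: "p ` ball 0 R \<subseteq> q ` unit_disc"
    and z: "z \<in> ball 0 R" and \<zeta>: "\<zeta> \<in> unit_disc" and lt: "cmod z < cmod \<zeta>" and "z \<noteq> 0"
    and pq: "p z = q \<zeta>" and m: "1 \<le> m" "z * deriv p z = of_real m * (\<zeta> * deriv q \<zeta>)"
  have sub: "ball 0 R \<subseteq> unit_disc" using R by auto
  \<comment> \<open>Only on this disc is \<open>p\<close> known to take values of \<open>q\<close>;
    there the power of \<open>p\<close> is holomorphic, and the identity of \<open>\<mu>\<close>-th
    roots can be continued from the origin to \<open>z\<close>.\<close>
  have slit: "p u \<notin> \<real>\<^sub>\<le>\<^sub>0" if "u \<in> ball 0 R" for u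
  proof -
    have "p u \<in> q ` unit_disc" using im that by (rule subsetD[OF _ imageI])
    then show ?thesis using q_slit by auto
  qed
  define b where "b = complex_of_real (\<alpha> / \<mu>)"
  have isCont: "isCont f 0" if "f holomorphic_on unit_disc" for f :: "complex \<Rightarrow> complex"
    using holomorphic_on_imp_continuous_on[OF that] by (simp add: continuous_on_eq_continuous_at)
  have comp: "(\<lambda>z. f (w z)) holomorphic_on unit_disc" if "f holomorphic_on unit_disc" for f
    using holomorphic_on_compose_gen[OF w(1) that w(2)] by (simp add: o_def)
  have disc: "\<forall>\<^sub>F z in nhds 0. z \<in> unit_disc"
    by (rule eventually_nhds_in_open) auto
  have Amu: "of_real (1 / \<mu>) * complex_of_real \<mu> = 1" "of_real (1 / \<mu>) * complex_of_real \<alpha> = b"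
    using params by (simp_all add: b_def)
  have A0: "A 0 = 1" using A(2)[of 0] p(2) by simp
  have "\<forall>\<^sub>F z in nhds 0. p z powr (of_real (1/\<mu>) * of_real \<alpha>) * A z powr (of_real (1/\<mu>) * of_real \<mu>)
      = q (w z) powr (of_real (1/\<mu>) * of_real \<alpha>) * C 1 (w z) powr (of_real (1/\<mu>) * of_real \<mu>)"
    using disc eq
    by (intro powr_identity_near_0 isCont p A comp q_hol C_hol)
      (auto simp: A0 p(2) w(3) q_0 C_0 elim: eventually_mono)
  then have "\<forall>\<^sub>F z in nhds 0. p z powr b * A z = H 1 (w z)"
    by (simp only: Amu) (simp add: H_def b_def)
  then obtain U where U: "open U" "0 \<in> U" "\<And>z. z \<in> U \<Longrightarrow> p z powr b * A z = H 1 (w z)"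
    unfolding eventually_nhds by blast
  have H_hol: "H 1 holomorphic_on unit_disc"
    unfolding H_def[abs_def] by (intro holomorphic_intros C_hol q_hol q_slit)
  have "p z powr b * A z = H 1 (w z)"
  proof (rule analytic_continuation_open[of "U \<inter> ball 0 R" "ball 0 R"
        "\<lambda>z. p z powr b * A z" "\<lambda>z. H 1 (w z)"])
    show "(\<lambda>z. p z powr b * A z) holomorphic_on ball 0 R"
      by (intro holomorphic_intros holomorphic_on_subset[OF p(1) sub]
          holomorphic_on_subset[OF A(1) sub] slit)
    show "(\<lambda>z. H 1 (w z)) holomorphic_on ball 0 R"
      by (rule holomorphic_on_subset[OF comp[OF H_hol] sub])
  qed (use U R z in auto)
  moreover have "A z = C m \<zeta>"
    using A(2)[of z] z sub pq m(2) by (simp add: C_def subset_iff)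
  ultimately have "H 1 (w z) = H m \<zeta>"
    by (simp add: H_def pq b_def)
  moreover have "cmod (w z) < cmod \<zeta>"
  proof -
    have "cmod (w z) \<le> cmod z"
      by (rule Schwarz_Lemma(1)[OF w(1,3)]) (use w(2) sub z in \<open>auto simp: image_subset_iff subset_iff\<close>)
    then show ?thesis using lt by simp
  qed
  ultimately show False
    using H_avoids[OF zero_le_one m(1) \<zeta>] by blast
qed

text \<open>\<open>C t z\<close> lies on the segment from \<open>q z\<close> to
  \<open>C 1 z\<close>, both off the slit. The segment misses 0, since a zero of \<open>H t\<close>
  would be a zero of \<open>H 1\<close> elsewhere, by subordination.\<close>

lemma C_slit:
  assumes slit: "\<And>z. z \<in> unit_disc \<Longrightarrow> C 1 z \<notin> \<real>\<^sub>\<le>\<^sub>0"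
    and t: "0 \<le> t" "t \<le> 1" and z: "z \<in> unit_disc"
  shows "C t z \<notin> \<real>\<^sub>\<le>\<^sub>0"
proof -
  have C_seg: "C s u = q u + of_real s * (C 1 u - q u)" for s u
    by (simp add: C_def)
  have nz: "C s u \<noteq> 0" if s: "0 \<le> s" "s \<le> 1" and u: "u \<in> unit_disc" for s u
  proof -
    obtain v where v: "v ` unit_disc \<subseteq> unit_disc" "H s u = H 1 (v u)"
      using H_subordinate[OF s] u by metis
    then have vu: "v u \<in> unit_disc" using u by blast
    have "H 1 (v u) \<noteq> 0"
      using q_nz[OF vu] slit[OF vu] by (auto simp: H_def)
    then show ?thesis using v(2) by (auto simp: H_def)
  qed
  have "q z + of_real t * (C 1 z - q z) \<notin> \<real>\<^sub>\<le>\<^sub>0"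
  proof (rule segment_avoids_slit[of unit_disc q "C 1" 0, OF _ _ _ q_slit slit _ _ _ z t])
    show "continuous_on unit_disc q" "continuous_on unit_disc (C 1)"
      by (intro holomorphic_on_imp_continuous_on q_hol C_hol)+
    show "q u + of_real s * (C 1 u - q u) \<noteq> 0"
      if "u \<in> unit_disc" "0 \<le> s" "s \<le> 1" for u s
      using nz that C_seg by metis
  qed (auto simp: q_0 C_0)
  then show ?thesis using C_seg by metis
qed

text \<open>The subordination of \<open>H t\<close> to \<open>H 1\<close> is raised to the power
  \<open>\<mu>\<close> near the origin and then continued. The slit condition is conditional because
  for \<open>\<mu> = 1\<close> the power of \<open>C\<close> is holomorphic anyway.\<close>

lemma powr_subordinate:
  assumes slit: "\<mu> \<noteq> 1 \<Longrightarrow> (\<And>z. z \<in> unit_disc \<Longrightarrow> C 1 z \<notin> \<real>\<^sub>\<le>\<^sub>0)"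
    and t: "0 \<le> t" "t \<le> 1"
  obtains v where "v holomorphic_on unit_disc" "v ` unit_disc \<subseteq> unit_disc" "v 0 = 0"
    "\<And>z. z \<in> unit_disc \<Longrightarrow> q z powr of_real \<alpha> * C t z powr of_real \<mu>
      = q (v z) powr of_real \<alpha> * C 1 (v z) powr of_real \<mu>"
proof -
  obtain v where v: "v holomorphic_on unit_disc" "v ` unit_disc \<subseteq> unit_disc" "v 0 = 0"
    "\<And>z. z \<in> unit_disc \<Longrightarrow> H t z = H 1 (v z)"
    using H_subordinate[OF t] by metis
  have isCont: "isCont f 0" if "f holomorphic_on unit_disc" for f :: "complex \<Rightarrow> complex"
    using holomorphic_on_imp_continuous_on[OF that] by (simp add: continuous_on_eq_continuous_at)
  have comp: "(\<lambda>z. f (v z)) holomorphic_on unit_disc" if "f holomorphic_on unit_disc" for f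
    using holomorphic_on_compose_gen[OF v(1) that v(2)] by (simp add: o_def)
  have disc: "\<forall>\<^sub>F z in nhds 0. z \<in> unit_disc"
    by (rule eventually_nhds_in_open) auto
  have ev: "\<forall>\<^sub>F z in nhds 0. q z powr of_real (\<alpha> / \<mu>) * C t z powr 1
      = q (v z) powr of_real (\<alpha> / \<mu>) * C 1 (v z) powr 1"
    using disc v(4) by (auto simp: H_def elim: eventually_mono)
  have "\<forall>\<^sub>F z in nhds 0. q z powr (of_real \<mu> * of_real (\<alpha> / \<mu>)) * C t z powr (of_real \<mu> * 1)
      = q (v z) powr (of_real \<mu> * of_real (\<alpha> / \<mu>)) * C 1 (v z) powr (of_real \<mu> * 1)"
    by (rule powr_identity_near_0[OF _ _ _ _ _ _ _ _ ev]) (auto intro!: isCont comp q_hol C_hol simp: v(3) q_0 C_0)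
  moreover have "complex_of_real \<mu> * of_real (\<alpha> / \<mu>) = of_real \<alpha>"
    using params by simp
  ultimately have "\<forall>\<^sub>F z in nhds 0. q z powr of_real \<alpha> * C t z powr of_real \<mu>
      = q (v z) powr of_real \<alpha> * C 1 (v z) powr of_real \<mu>"
    by (simp only: mult_1_right)
  then obtain U where U: "open U" "0 \<in> U" "\<And>z. z \<in> U \<Longrightarrow>
      q z powr of_real \<alpha> * C t z powr of_real \<mu> = q (v z) powr of_real \<alpha> * C 1 (v z) powr of_real \<mu>"
    unfolding eventually_nhds by blast
  have C_powr_hol: "(\<lambda>z. C s z powr of_real \<mu>) holomorphic_on unit_disc" if s: "0 \<le> s" "s \<le> 1" for s
  proof (cases "\<mu> = 1")
    case True
    then show ?thesis using C_hol by simp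
  next
    case False
    show ?thesis
      by (intro holomorphic_intros C_hol C_slit[OF slit[OF False]] s)
  qed
  show thesis
  proof (rule that[OF v(1-3)])
    fix z assume z: "z \<in> unit_disc"
    show "q z powr of_real \<alpha> * C t z powr of_real \<mu> = q (v z) powr of_real \<alpha> * C 1 (v z) powr of_real \<mu>"
    proof (rule analytic_continuation_open[of "U \<inter> unit_disc" unit_disc
          "\<lambda>z. q z powr of_real \<alpha> * C t z powr of_real \<mu>"
          "\<lambda>z. q (v z) powr of_real \<alpha> * C 1 (v z) powr of_real \<mu>"])
      show "(\<lambda>z. q z powr of_real \<alpha> * C t z powr of_real \<mu>) holomorphic_on unit_disc"
        by (intro holomorphic_on_mult qpow_hol C_powr_hol t)
      show "(\<lambda>z. q (v z) powr of_real \<alpha> * C 1 (v z) powr of_real \<mu>) holomorphic_on unit_disc"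
        by (rule comp) (intro holomorphic_on_mult qpow_hol C_powr_hol zero_le_one order_refl)
    qed (use U z in auto)
  qed
qed

text \<open>At a contact \<open>q z = p \<zeta>\<close>, the expression for \<open>p\<close> at
  \<open>\<zeta>\<close> is the one for \<open>q\<close> at \<open>z\<close> with
  \<open>t = 1 / m\<close>. Two subordinations lead to its value at \<open>w (v z)\<close>;
  injectivity gives \<open>\<zeta> = w (v z)\<close>, and Schwarz's lemma contradicts
  \<open>cmod z < cmod \<zeta>\<close>.\<close>

lemma subordinant:
  assumes p: "p holomorphic_on unit_disc" "inj_on p unit_disc" "p 0 = 1"
    and A: "\<And>z. z \<in> unit_disc \<Longrightarrow> A z = p z + l * (z * deriv p z / p z)"
    and slit: "\<mu> \<noteq> 1 \<Longrightarrow> (\<And>z. z \<in> unit_disc \<Longrightarrow> C 1 z \<notin> \<real>\<^sub>\<le>\<^sub>0)"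
    and w: "w holomorphic_on unit_disc" "w ` unit_disc \<subseteq> unit_disc" "w 0 = 0"
    and P_inj: "inj_on (\<lambda>z. p z powr of_real \<alpha> * A z powr of_real \<mu>) unit_disc"
    and eq: "\<And>z. z \<in> unit_disc \<Longrightarrow> q z powr of_real \<alpha> * C 1 z powr of_real \<mu>
      = p (w z) powr of_real \<alpha> * A (w z) powr of_real \<mu>"
  shows "\<exists>w. w holomorphic_on unit_disc \<and> w ` unit_disc \<subseteq> unit_disc \<and> w 0 = 0 \<and>
    (\<forall>z\<in>unit_disc. q z = p (w z))"
proof (rule subordination_principle[OF q_hol p(1,2)])
  show "q 0 = p 0" by (simp add: p q_0)
  fix R z \<zeta> and m :: real
  assume R: "0 < R" "R \<le> 1" and z: "z \<in> ball 0 R" and \<zeta>: "\<zeta> \<in> unit_disc"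
    and lt: "cmod z < cmod \<zeta>" and qp: "q z = p \<zeta>"
    and m: "1 \<le> m" "z * deriv q z = of_real m * (\<zeta> * deriv p \<zeta>)"
  have z1: "z \<in> unit_disc" using z R by auto
  define t where "t = 1 / m"
  have t: "0 \<le> t" "t \<le> 1" using m by (auto simp: t_def)
  obtain v where v: "v holomorphic_on unit_disc" "v ` unit_disc \<subseteq> unit_disc" "v 0 = 0"
    "\<And>z. z \<in> unit_disc \<Longrightarrow> q z powr of_real \<alpha> * C t z powr of_real \<mu>
      = q (v z) powr of_real \<alpha> * C 1 (v z) powr of_real \<mu>"
    using powr_subordinate[OF slit t] by metis
  have vz: "v z \<in> unit_disc" using v(2) z1 by blast
  have wvz: "w (v z) \<in> unit_disc" using w(2) vz by blast
  have "of_real t * (z * deriv q z) = \<zeta> * deriv p \<zeta>"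
    using m by (simp add: t_def)
  then have "A \<zeta> = C t z"
    using A[OF \<zeta>] by (simp add: C_def qp)
  then have "p \<zeta> powr of_real \<alpha> * A \<zeta> powr of_real \<mu>
      = p (w (v z)) powr of_real \<alpha> * A (w (v z)) powr of_real \<mu>"
    using v(4)[OF z1] eq[OF vz] by (simp add: qp)
  then have "\<zeta> = w (v z)"
    using inj_onD[OF P_inj _ \<zeta> wvz] by blast
  moreover have "cmod (w (v z)) \<le> cmod (v z)"
    by (rule Schwarz_Lemma(1)[OF w(1,3)]) (use w(2) vz in \<open>auto simp: image_subset_iff\<close>)
  moreover have "cmod (v z) \<le> cmod z"
    by (rule Schwarz_Lemma(1)[OF v(1,3)]) (use v(2) z1 in \<open>auto simp: image_subset_iff\<close>)
  ultimately show False using lt by simp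
qed

end

section \<open>Application to the logarithmic derivatives\<close>

lemma power_chain_zlogderiv:
  assumes "0 < \<mu>" "\<alpha> + \<mu> > 0" "l \<noteq> 0" "univalent (zlogderiv g)"
    and "\<forall>z\<in>unit_disc. Re (1 / l * zlogderiv g z) > 0"
    and "\<forall>z\<in>unit_disc.
           Re (complex_of_real (\<alpha> / \<mu> - 1) * (z * deriv (zlogderiv g) z / zlogderiv g z) + 1
               + z * deriv (deriv (zlogderiv g)) z / deriv (zlogderiv g) z) > 0"
  shows "power_chain \<alpha> \<mu> l (zlogderiv g)"
  using assms by unfold_locales (auto simp: zlogderiv_def[of _ 0])

theorem theorem3p1:
  fixes \<alpha> \<mu> :: real and l :: complex and f g\<^sub>1 g\<^sub>2 :: "complex \<Rightarrow> complex"
  assumes "0 < \<mu>" "\<mu> \<le> 1" "\<alpha> + \<mu> > 0" "l \<noteq> 0"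
    and "g\<^sub>1 \<in> class_A" "g\<^sub>2 \<in> class_A"
    and "\<forall>g\<in>{g\<^sub>1, g\<^sub>2}. univalent (zlogderiv g)"
    and "\<forall>g\<in>{g\<^sub>1, g\<^sub>2}. \<forall>z\<in>unit_disc. Re (1 / l * zlogderiv g z) > 0"
    and "\<forall>g\<in>{g\<^sub>1, g\<^sub>2}. \<forall>z\<in>unit_disc.
           Re (complex_of_real (\<alpha> / \<mu> - 1) * (z * deriv (zlogderiv g) z / zlogderiv g z) + 1
               + z * deriv (deriv (zlogderiv g)) z / deriv (zlogderiv g) z) > 0"
    and "\<forall>g\<in>{g\<^sub>1, g\<^sub>2}. powers_analytic \<alpha> \<mu> l g"
    and "f \<in> class_A"
    and "\<forall>z\<in>unit_disc. zlogderiv f z \<noteq> 0"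
    and "zlogderiv f \<in> class_H11 \<inter> class_Q"
    and "powers_analytic \<alpha> \<mu> l f"
    and "univalent (power_expr \<alpha> \<mu> l f)"
    and "power_expr \<alpha> \<mu> l g\<^sub>1 \<prec> power_expr \<alpha> \<mu> l f"
    and "power_expr \<alpha> \<mu> l f \<prec> power_expr \<alpha> \<mu> l g\<^sub>2"
  shows "zlogderiv g\<^sub>1 \<prec> zlogderiv f \<and> zlogderiv f \<prec> zlogderiv g\<^sub>2"
proof -
  define p where "p = zlogderiv f"
  define A where "A z = p z + l * (z * deriv p z / p z)" for z
  have p_hol: "p holomorphic_on unit_disc" and p_nz: "\<And>z. z \<in> unit_disc \<Longrightarrow> p z \<noteq> 0" and p_0: "p 0 = 1"
    using assms(12,13) by (auto simp: p_def class_H11_def class_H_def)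
  have A_eq: "affine_comb l f z = A z" if "z \<in> unit_disc" for z
    unfolding A_def p_def by (rule affine_comb_eq[OF assms(11) _ that]) (use assms(12) in blast)
  have A_hol: "A holomorphic_on unit_disc"
    unfolding A_def[abs_def] by (intro holomorphic_intros p_hol p_nz holomorphic_deriv) auto
  have P_eq: "power_expr \<alpha> \<mu> l f z = p z powr of_real \<alpha> * A z powr of_real \<mu>" if "z \<in> unit_disc" for z
    using A_eq[OF that] by (simp add: power_expr_def p_def)
  interpret q1: power_chain \<alpha> \<mu> l "zlogderiv g\<^sub>1"
    by (rule power_chain_zlogderiv) (use assms in auto)
  interpret q2: power_chain \<alpha> \<mu> l "zlogderiv g\<^sub>2"
    by (rule power_chain_zlogderiv) (use assms in auto)
  have C1: "affine_comb l g\<^sub>1 z = q1.C 1 z" if "z \<in> unit_disc" for z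
    using affine_comb_eq[OF assms(5) q1.q_nz that] by (simp add: q1.C_def)
  have C2: "affine_comb l g\<^sub>2 z = q2.C 1 z" if "z \<in> unit_disc" for z
    using affine_comb_eq[OF assms(6) q2.q_nz that] by (simp add: q2.C_def)
  \<comment> \<open>The exceptional set lies on the unit circle, so membership in
    \<open>class_Q\<close> includes injectivity on the open disc.\<close>
  have p_inj: "inj_on p unit_disc"
  proof -
    obtain F where F: "\<forall>z\<in>unit_disc. F z = zlogderiv f z" "inj_on F (cball 0 1 - exc_set (zlogderiv f))"
      using assms(13) by (auto simp: class_Q_def)
    have "unit_disc \<subseteq> cball 0 1 - exc_set (zlogderiv f)" by (auto simp: exc_set_def)
    with F(2) have "inj_on F unit_disc" by (rule inj_on_subset)
    then show ?thesis using F(1) by (simp add: inj_on_def p_def)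
  qed
  have P_inj: "inj_on (\<lambda>z. p z powr of_real \<alpha> * A z powr of_real \<mu>) unit_disc"
    using assms(15) by (simp add: univalent_def inj_on_def P_eq)
  \<comment> \<open>The standing assumption that the principal powers are analytic is converted here
    into a condition on values.\<close>
  have slit: "q1.C 1 z \<notin> \<real>\<^sub>\<le>\<^sub>0" if "\<mu> \<noteq> 1" "z \<in> unit_disc" for z
  proof (rule holomorphic_powr_imp_slit[OF q1.C_hol q1.C_0 assms(1) _ _ that(2)])
    show "\<mu> < 1" using assms(2) that(1) by simp
    have "(\<lambda>z. affine_comb l g\<^sub>1 z powr of_real \<mu>) holomorphic_on unit_disc"
      using assms(10) by (simp add: powers_analytic_def)
    then show "(\<lambda>z. q1.C 1 z powr of_real \<mu>) holomorphic_on unit_disc"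
      by (rule holomorphic_transform) (simp add: C1)
  qed
  obtain w1 where w1: "w1 holomorphic_on unit_disc" "w1 ` unit_disc \<subseteq> unit_disc" "w1 0 = 0"
    "\<And>z. z \<in> unit_disc \<Longrightarrow> power_expr \<alpha> \<mu> l g\<^sub>1 z = power_expr \<alpha> \<mu> l f (w1 z)"
    using assms(16) by (auto simp: subordinate_def)
  obtain w2 where w2: "w2 holomorphic_on unit_disc" "w2 ` unit_disc \<subseteq> unit_disc" "w2 0 = 0"
    "\<And>z. z \<in> unit_disc \<Longrightarrow> power_expr \<alpha> \<mu> l f z = power_expr \<alpha> \<mu> l g\<^sub>2 (w2 z)"
    using assms(17) by (auto simp: subordinate_def)
  have eq1: "zlogderiv g\<^sub>1 z powr of_real \<alpha> * q1.C 1 z powr of_real \<mu>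
      = p (w1 z) powr of_real \<alpha> * A (w1 z) powr of_real \<mu>" if z: "z \<in> unit_disc" for z
  proof -
    have "w1 z \<in> unit_disc" using w1(2) z by blast
    then show ?thesis using w1(4)[OF z] C1[OF z] P_eq by (simp add: power_expr_def[of _ _ _ g\<^sub>1])
  qed
  have eq2: "p z powr of_real \<alpha> * A z powr of_real \<mu>
      = zlogderiv g\<^sub>2 (w2 z) powr of_real \<alpha> * q2.C 1 (w2 z) powr of_real \<mu>" if z: "z \<in> unit_disc" for z
  proof -
    have "w2 z \<in> unit_disc" using w2(2) z by blast
    then show ?thesis using w2(4)[OF z] C2 P_eq[OF z] by (simp add: power_expr_def[of _ _ _ g\<^sub>2])
  qed
  have "\<exists>w. w holomorphic_on unit_disc \<and> w ` unit_disc \<subseteq> unit_disc \<and> w 0 = 0 \<and>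
      (\<forall>z\<in>unit_disc. zlogderiv g\<^sub>1 z = p (w z))"
    by (rule q1.subordinant[OF p_hol p_inj p_0 _ slit w1(1-3) P_inj eq1]) (simp_all add: A_def)
  moreover have "\<exists>w. w holomorphic_on unit_disc \<and> w ` unit_disc \<subseteq> unit_disc \<and> w 0 = 0 \<and>
      (\<forall>z\<in>unit_disc. p z = zlogderiv g\<^sub>2 (w z))"
    by (rule q2.dominant[OF p_hol p_0 A_hol _ w2(1-3) eq2]) (simp_all add: A_def)
  ultimately show ?thesis
    using p_hol q1.q_hol q2.q_hol by (simp add: subordinate_def class_H_def p_def)
qed

end
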